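(* For every integer $k\ge 2$, $\mu\bigl(I_{\overline{C_{2k}}\to\Lambda}\bigr)=k$, where $\overline{C_{2k}}$ is the (loopless) complement of the cycle $C_{2k}$ on $2k$ vertices.
   Context: Graphs are finite and undirected without multiple edges; loops are allowed in general. $\mathrm{Hom}(G,H)$ is the set of graph homomorphisms, i.e. maps $\phi:V(G)\to V(H)$ with $\phi(u)\phi(v)\in E(H)$ whenever $uv\in E(G)$. Fix a field $\mathbf{k}$. For $e\in E(G)$ let $G[e]$ be the subgraph consisting only of $e$ and its endpoint(s). Put $R_{G\to H}=\mathbf{k}[r_\phi : \phi\in\mathrm{Hom}(G,H)]$ and $S_{G\to H}=\mathbf{k}[s_\psi : e\in E(G),\ \psi\in \mathrm{Hom}(G[e],H)]$. Let $\Phi_{G\to H}:R_{G\to H}\to S_{G\to H}$ be the $\mathbf{k}$-algebra map with $\Phi(r_\phi)=\prod_{e\in E(G)} s_{\phi|_e}$, and $I_{G\to H}=\ker\Phi_{G\to H}$. $\Lambda$ is the graph with two vertices joined by an edge and with a loop at exactly one of the two vertices (so $\mathrm{Hom}(G,\Lambda)$ corresponds to the independent sets of $G$, as preimages of the unlooped vertex). The Markov width $\mu(I)$ of a toric ideal $I$ is the smallest $d$ such that $I$ is generated by binomials (differences of two monomials) in $I$ of degree at most $d$; $\mu(0)=0$. *)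

theory Defs
  imports "HOL-Library.FuncSet" "HOL-Library.Poly_Mapping" "HOL-Algebra.Ideal" "HOL-Algebra.RingHom"
begin

section \<open>Graphs and homomorphisms\<close>

text \<open>An edge is the set of its endpoints, so it has two elements, or one element if it is a loop.\<close>

record 'v ugraph =
  verts :: "'v set"
  edges :: "'v set set"

definition finite_graph :: "'v ugraph \<Rightarrow> bool" where
  "finite_graph G \<longleftrightarrow> finite (verts G) \<and>
     edges G \<subseteq> {{u, v} | u v. u \<in> verts G \<and> v \<in> verts G}"

text \<open>Homomorphisms are \<^const>\<open>extensional\<close>, so that each one is counted once.\<close>

definition graph_homs :: "'v ugraph \<Rightarrow> 'w ugraph \<Rightarrow> ('v \<Rightarrow> 'w) set" where
  "graph_homs G H = {\<phi> \<in> verts G \<rightarrow>\<^sub>E verts H.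
     \<forall>u v. {u, v} \<in> edges G \<longrightarrow> {\<phi> u, \<phi> v} \<in> edges H}"

definition edge_subgraph :: "'v set \<Rightarrow> 'v ugraph" where
  "edge_subgraph e = \<lparr>verts = e, edges = {e}\<rparr>"

definition cycle_graph :: "nat \<Rightarrow> nat ugraph" where
  "cycle_graph n = \<lparr>verts = {..<n}, edges = {{i, (i + 1) mod n} | i. i < n}\<rparr>"

definition complement_graph :: "'v ugraph \<Rightarrow> 'v ugraph" where
  "complement_graph G = \<lparr>verts = verts G,
     edges = {{u, v} | u v. u \<in> verts G \<and> v \<in> verts G \<and> u \<noteq> v \<and> {u, v} \<notin> edges G}\<rparr>"

definition Lambda_graph :: "nat ugraph" where
  "Lambda_graph = \<lparr>verts = {0, 1}, edges = {{0, 1}, {0}}\<rparr>"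

lemma finite_graph_complement_cycle: "finite_graph (complement_graph (cycle_graph n))"
  by (auto simp: finite_graph_def complement_graph_def cycle_graph_def)

lemma finite_graph_cycle: "finite_graph (cycle_graph n)"
  by (fastforce simp: finite_graph_def cycle_graph_def)

lemma finite_graph_Lambda: "finite_graph Lambda_graph"
  by (auto simp: finite_graph_def Lambda_graph_def)

lemma edge_subset_verts: "finite_graph G \<Longrightarrow> e \<in> edges G \<Longrightarrow> e \<subseteq> verts G"
  by (auto simp: finite_graph_def)

lemma restrict_graph_homs:
  assumes "finite_graph G" "\<phi> \<in> graph_homs G H" "e \<in> edges G"
  shows "restrict \<phi> e \<in> graph_homs (edge_subgraph e) H"
  using edge_subset_verts[OF assms(1,3)] assms(2,3)
  by (auto simp: graph_homs_def edge_subgraph_def)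


section \<open>Polynomial rings\<close>

text \<open>Monomials are finitely supported exponent functions, polynomials are finitely supported
  functions from monomials to coefficients. The ring \<open>\<^bold>k[x : x \<in> X]\<close> consists of those
  polynomials in which only variables from \<open>X\<close> occur.\<close>

type_synonym ('x, 'k) mpoly = "('x \<Rightarrow>\<^sub>0 nat) \<Rightarrow>\<^sub>0 'k"

definition mpoly_ring :: "'x set \<Rightarrow> ('x, 'k::field) mpoly ring" where
  "mpoly_ring X = \<lparr>carrier = {p. \<forall>m \<in> Poly_Mapping.keys p. Poly_Mapping.keys m \<subseteq> X},
     mult = (*), one = 1, zero = 0, add = (+)\<rparr>"

definition mpoly_monom :: "('x \<Rightarrow>\<^sub>0 nat) \<Rightarrow> ('x, 'k::field) mpoly" where
  "mpoly_monom m = Poly_Mapping.single m 1"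

definition mpoly_const :: "'k::field \<Rightarrow> ('x, 'k) mpoly" where
  "mpoly_const c = Poly_Mapping.single 0 c"

definition mpoly_var :: "'x \<Rightarrow> ('x, 'k::field) mpoly" where
  "mpoly_var x = mpoly_monom (Poly_Mapping.single x 1)"

definition monom_degree :: "('x \<Rightarrow>\<^sub>0 nat) \<Rightarrow> nat" where
  "monom_degree m = (\<Sum>x \<in> Poly_Mapping.keys m. Poly_Mapping.lookup m x)"

definition total_degree :: "('x, 'k::field) mpoly \<Rightarrow> nat" where
  "total_degree p = Max (insert 0 (monom_degree ` Poly_Mapping.keys p))"

text \<open>The \<open>\<^bold>k\<close>-algebra homomorphism sending each variable \<open>x\<close> to \<open>f x\<close>.\<close>

definition mpoly_subst :: "('x \<Rightarrow> ('y, 'k::field) mpoly) \<Rightarrow> ('x, 'k) mpoly \<Rightarrow> ('y, 'k) mpoly" where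
  "mpoly_subst f p = (\<Sum>m \<in> Poly_Mapping.keys p.
     mpoly_const (Poly_Mapping.lookup p m) *
     (\<Prod>x \<in> Poly_Mapping.keys m. f x ^ Poly_Mapping.lookup m x))"


section \<open>Toric ideals of graph homomorphisms and Markov width\<close>

abbreviation R_ring :: "'v ugraph \<Rightarrow> 'w ugraph \<Rightarrow> ('v \<Rightarrow> 'w, 'k::field) mpoly ring" where
  "R_ring G H \<equiv> mpoly_ring (graph_homs G H)"

abbreviation S_ring ::
  "'v ugraph \<Rightarrow> 'w ugraph \<Rightarrow> ('v set \<times> ('v \<Rightarrow> 'w), 'k::field) mpoly ring" where
  "S_ring G H \<equiv> mpoly_ring (SIGMA e : edges G. graph_homs (edge_subgraph e) H)"

definition Phi_map :: "'v ugraph \<Rightarrow>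
    ('v \<Rightarrow> 'w, 'k::field) mpoly \<Rightarrow> ('v set \<times> ('v \<Rightarrow> 'w), 'k) mpoly" where
  "Phi_map G = mpoly_subst (\<lambda>\<phi>. \<Prod>e \<in> edges G. mpoly_var (e, restrict \<phi> e))"

definition toric_ideal :: "'v ugraph \<Rightarrow> 'w ugraph \<Rightarrow> ('v \<Rightarrow> 'w, 'k::field) mpoly set" where
  "toric_ideal G H = a_kernel (R_ring G H) (S_ring G H) (Phi_map G)"

definition binomials_upto :: "('x, 'k::field) mpoly set \<Rightarrow> nat \<Rightarrow> ('x, 'k) mpoly set" where
  "binomials_upto I d = {b \<in> I. (\<exists>m m'. b = mpoly_monom m - mpoly_monom m') \<and> total_degree b \<le> d}"

text \<open>Taking \<open>m = m'\<close> above makes \<open>0\<close> a binomial of degree \<open>0\<close>; this adds nothing to the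
  generated ideal. The zero ideal has Markov width \<open>0\<close>.\<close>

definition markov_width :: "'x set \<Rightarrow> ('x, 'k::field) mpoly set \<Rightarrow> nat" where
  "markov_width X I = (LEAST d. I = Idl\<^bsub>mpoly_ring X\<^esub> (binomials_upto I d))"


section \<open>Basic properties\<close>

lemma cring_mpoly_ring: "cring (mpoly_ring X :: ('x, 'k::field) mpoly ring)"
proof (rule cringI)
  show "abelian_group (mpoly_ring X :: ('x, 'k) mpoly ring)"
  proof (rule abelian_groupI)
    fix p :: "('x, 'k) mpoly"
    assume p: "p \<in> carrier (mpoly_ring X)"
    show "\<exists>q \<in> carrier (mpoly_ring X). q \<oplus>\<^bsub>mpoly_ring X\<^esub> p = \<zero>\<^bsub>mpoly_ring X\<^esub>"
      using p by (intro bexI[of _ "- p"]) (auto simp: mpoly_ring_def)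
  qed (use Poly_Mapping.keys_add in \<open>fastforce simp: mpoly_ring_def algebra_simps\<close>)+
  show "Group.comm_monoid (mpoly_ring X :: ('x, 'k) mpoly ring)"
  proof (rule comm_monoidI)
    fix p q :: "('x, 'k) mpoly"
    assume pq: "p \<in> carrier (mpoly_ring X)" "q \<in> carrier (mpoly_ring X)"
    have "Poly_Mapping.keys m \<subseteq> X" if m: "m \<in> Poly_Mapping.keys (p * q)" for m
    proof -
      obtain a b where "m = a + b" "a \<in> Poly_Mapping.keys p" "b \<in> Poly_Mapping.keys q"
        using m keys_mult[of p q] by blast
      then show ?thesis
        using pq Poly_Mapping.keys_add[of a b] unfolding mpoly_ring_def by simp blast
    qed
    then show "p \<otimes>\<^bsub>mpoly_ring X\<^esub> q \<in> carrier (mpoly_ring X)"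
      by (simp add: mpoly_ring_def)
  qed (auto simp: mpoly_ring_def algebra_simps)
qed (auto simp: mpoly_ring_def algebra_simps)

lemma mpoly_subst_eq_sum:
  assumes "finite A" "Poly_Mapping.keys p \<subseteq> A"
  shows "mpoly_subst f p = (\<Sum>m \<in> A. mpoly_const (Poly_Mapping.lookup p m) *
     (\<Prod>x \<in> Poly_Mapping.keys m. f x ^ Poly_Mapping.lookup m x))"
  unfolding mpoly_subst_def
  by (rule sum.mono_neutral_left) (use assms in \<open>auto simp: mpoly_const_def in_keys_iff\<close>)

lemma mpoly_subst_add: "mpoly_subst f (p + q) = mpoly_subst f p + mpoly_subst f q"
proof -
  let ?A = "Poly_Mapping.keys p \<union> Poly_Mapping.keys q"
  have "mpoly_subst f r = (\<Sum>m \<in> ?A. mpoly_const (Poly_Mapping.lookup r m) *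
     (\<Prod>x \<in> Poly_Mapping.keys m. f x ^ Poly_Mapping.lookup m x))"
    if "Poly_Mapping.keys r \<subseteq> ?A" for r
    using that by (intro mpoly_subst_eq_sum) auto
  from this[of p] this[of q] this[of "p + q"] show ?thesis
    using Poly_Mapping.keys_add[of p q]
    by (simp add: lookup_add mpoly_const_def single_add distrib_right sum.distrib)
qed

lemma mpoly_subst_single: "mpoly_subst f (Poly_Mapping.single m c) =
    mpoly_const c * (\<Prod>x \<in> Poly_Mapping.keys m. f x ^ Poly_Mapping.lookup m x)"
  by (subst mpoly_subst_eq_sum[where A = "{m}"]) auto

lemma mpoly_subst_const: "mpoly_subst f (mpoly_const c) = mpoly_const c"
  unfolding mpoly_const_def by (subst mpoly_subst_single) (simp add: mpoly_const_def)

lemma mpoly_subst_var: "mpoly_subst f (mpoly_var x) = f x"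
  by (simp add: mpoly_var_def mpoly_monom_def mpoly_subst_single mpoly_const_def)

lemma mpoly_subst_zero: "mpoly_subst f 0 = 0"
  by (simp add: mpoly_subst_def)

lemma mpoly_subst_one: "mpoly_subst f 1 = 1"
  using mpoly_subst_const[of f 1] by (simp add: mpoly_const_def)

lemma prod_power_add:
  fixes f :: "'x \<Rightarrow> ('y, 'k::field) mpoly"
  shows "(\<Prod>x \<in> Poly_Mapping.keys (a + b). f x ^ Poly_Mapping.lookup (a + b) x) =
    (\<Prod>x \<in> Poly_Mapping.keys a. f x ^ Poly_Mapping.lookup a x) *
    (\<Prod>x \<in> Poly_Mapping.keys b. f x ^ Poly_Mapping.lookup b x)"
proof -
  let ?A = "Poly_Mapping.keys a \<union> Poly_Mapping.keys b"
  have "(\<Prod>x \<in> Poly_Mapping.keys c. f x ^ Poly_Mapping.lookup c x) =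
        (\<Prod>x \<in> ?A. f x ^ Poly_Mapping.lookup c x)" if "Poly_Mapping.keys c \<subseteq> ?A" for c
    using that by (intro prod.mono_neutral_left) (auto simp: in_keys_iff)
  from this[of a] this[of b] this[of "a + b"] show ?thesis
    using Poly_Mapping.keys_add[of a b]
    by (simp add: lookup_add power_add prod.distrib)
qed

lemma mpoly_const_mult: "mpoly_const (c * d) = mpoly_const c * mpoly_const d"
  by (simp add: mpoly_const_def mult_single)

lemma mpoly_induct [case_names single add]:
  fixes p :: "('x, 'k::field) mpoly"
  assumes single: "\<And>m c. P (Poly_Mapping.single m c)"
    and add: "\<And>p q. P p \<Longrightarrow> P q \<Longrightarrow> P (p + q)"
  shows "P p"
proof -
  have "P (\<Sum>m \<in> A. Poly_Mapping.single m (Poly_Mapping.lookup p m))" for A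
    by (induction A rule: infinite_finite_induct)
       (use single[of 0 0] in \<open>auto intro: add single\<close>)
  moreover have "(\<Sum>m \<in> Poly_Mapping.keys p. Poly_Mapping.single m (Poly_Mapping.lookup p m)) = p"
    by (rule poly_mapping_eqI)
       (auto simp: lookup_sum lookup_single when_def in_keys_iff)
  ultimately show ?thesis
    by metis
qed

lemma mpoly_subst_mult: "mpoly_subst f (p * q) = mpoly_subst f p * mpoly_subst f q"
proof (induction p rule: mpoly_induct)
  case (single m c)
  show ?case
  proof (induction q rule: mpoly_induct)
    case (single m' c')
    show ?case
      by (simp only: mult_single mpoly_subst_single prod_power_add mpoly_const_mult ac_simps)
  qed (simp add: distrib_left mpoly_subst_add)
qed (simp add: distrib_right mpoly_subst_add)

lemma markov_width_zero: "markov_width X ({0} :: ('x, 'k::field) mpoly set) = 0"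
proof -
  interpret cring "mpoly_ring X :: ('x, 'k) mpoly ring"
    by (rule cring_mpoly_ring)
  have "0 = (mpoly_monom 0 - mpoly_monom 0 :: ('x, 'k) mpoly)"
    by simp
  then have "0 \<in> binomials_upto {0 :: ('x, 'k) mpoly} 0"
    unfolding binomials_upto_def by (simp add: total_degree_def) blast
  moreover have "binomials_upto {0} 0 \<subseteq> {0 :: ('x, 'k) mpoly}"
    unfolding binomials_upto_def by blast
  ultimately have "binomials_upto {0} 0 = {0 :: ('x, 'k) mpoly}"
    by blast
  moreover have "{0 :: ('x, 'k) mpoly} = Idl\<^bsub>mpoly_ring X\<^esub> {0}"
    using genideal_zero by (simp add: mpoly_ring_def)
  ultimately show ?thesis
    unfolding markov_width_def by (intro Least_equality) auto
qed

lemma mpoly_subst_closed: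
  fixes f :: "'x \<Rightarrow> ('y, 'k::field) mpoly"
  assumes f: "\<And>x. x \<in> X \<Longrightarrow> f x \<in> carrier (mpoly_ring Y)"
    and p: "p \<in> carrier (mpoly_ring X)"
  shows "mpoly_subst f p \<in> carrier (mpoly_ring Y)"
proof -
  interpret Y: cring "mpoly_ring Y :: ('y, 'k) mpoly ring"
    by (rule cring_mpoly_ring)
  have mult: "a * b \<in> carrier (mpoly_ring Y)"
    if "a \<in> carrier (mpoly_ring Y)" "b \<in> carrier (mpoly_ring Y)" for a b :: "('y, 'k) mpoly"
    using Y.m_closed[OF that] by (simp add: mpoly_ring_def)
  have add: "a + b \<in> carrier (mpoly_ring Y)"
    if "a \<in> carrier (mpoly_ring Y)" "b \<in> carrier (mpoly_ring Y)" for a b :: "('y, 'k) mpoly"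
    using Y.a_closed[OF that] by (simp add: mpoly_ring_def)
  have const: "mpoly_const c \<in> carrier (mpoly_ring Y)" for c :: 'k
    by (auto simp: mpoly_ring_def mpoly_const_def)
  have one: "1 \<in> carrier (mpoly_ring Y :: ('y, 'k) mpoly ring)"
    and zero: "0 \<in> carrier (mpoly_ring Y :: ('y, 'k) mpoly ring)"
    by (auto simp: mpoly_ring_def)
  have power: "a ^ n \<in> carrier (mpoly_ring Y)"
    if "a \<in> carrier (mpoly_ring Y)" for a :: "('y, 'k) mpoly" and n
    using that by (induction n) (auto intro: mult one)
  have prod: "(\<Prod>x \<in> A. g x) \<in> carrier (mpoly_ring Y)"
    if "\<And>x. x \<in> A \<Longrightarrow> g x \<in> carrier (mpoly_ring Y)" for A :: "'x set" and g :: "'x \<Rightarrow> ('y, 'k) mpoly"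
    using that by (induction A rule: infinite_finite_induct) (auto intro: mult one)
  have sum: "(\<Sum>x \<in> A. g x) \<in> carrier (mpoly_ring Y)"
    if "\<And>x. x \<in> A \<Longrightarrow> g x \<in> carrier (mpoly_ring Y)"
    for A :: "('x \<Rightarrow>\<^sub>0 nat) set" and g :: "_ \<Rightarrow> ('y, 'k) mpoly"
    using that by (induction A rule: infinite_finite_induct) (auto intro: add zero)
  show ?thesis
    unfolding mpoly_subst_def
    by (intro sum mult const prod power f) (use p in \<open>auto simp: mpoly_ring_def\<close>)
qed

lemma Phi_map_ring_hom:
  assumes "finite_graph G"
  shows "(Phi_map G :: ('v \<Rightarrow> 'w, 'k::field) mpoly \<Rightarrow> _) \<in> ring_hom (R_ring G H) (S_ring G H)"
proof -
  let ?S = "S_ring G H :: ('v set \<times> ('v \<Rightarrow> 'w), 'k) mpoly ring"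
  interpret S: cring ?S
    by (rule cring_mpoly_ring)
  have "(\<Prod>e \<in> E. mpoly_var (e, restrict \<phi> e)) \<in> carrier ?S"
    if "\<phi> \<in> graph_homs G H" "E \<subseteq> edges G" for \<phi> E
    using that(2)
  proof (induction E rule: infinite_finite_induct)
    case (insert e E)
    have "(mpoly_var (e, restrict \<phi> e) :: ('v set \<times> ('v \<Rightarrow> 'w), 'k) mpoly) \<in> carrier ?S"
      using restrict_graph_homs[OF assms that(1)] insert.prems
      by (auto simp: mpoly_ring_def mpoly_var_def mpoly_monom_def)
    then have "mpoly_var (e, restrict \<phi> e) \<otimes>\<^bsub>?S\<^esub> (\<Prod>e \<in> E. mpoly_var (e, restrict \<phi> e)) \<in> carrier ?S"
      by (intro S.m_closed insert.IH) (use insert.prems in auto)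
    then show ?case
      using insert.hyps by (simp add: mpoly_ring_def del: restrict_apply)
  qed (auto simp: mpoly_ring_def)
  then have "Phi_map G p \<in> carrier ?S" if "p \<in> carrier (R_ring G H)" for p
    unfolding Phi_map_def by (rule mpoly_subst_closed) (use that in auto)
  then show ?thesis
    by (intro ring_hom_memI)
       (auto simp: mpoly_ring_def Phi_map_def mpoly_subst_add mpoly_subst_mult mpoly_subst_one)
qed

end

theory Submission
  imports Defs
begin

text \<open>Homomorphisms from the complement of \<open>C\<^sub>2\<^sub>k\<close> to \<open>\<Lambda>\<close> are the cliques of \<open>C\<^sub>2\<^sub>k\<close>: the empty set,
  the vertices and the edges of the cycle. A monomial is a multiset of cliques, and its image under
  \<open>\<Phi>\<close> amounts to its degree together with the number of cliques covering each vertex. Hence a monomial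
  is determined within its fibre by the multiplicities of the edges.

  Let two monomials of one fibre have edge multiplicities \<open>c\<close> and \<open>c'\<close>. If some edge with \<open>c < c'\<close> has an
  endpoint that occurs as a singleton in the first monomial, a quadratic move
  \<open>{v}, {v+1} \<rightarrow> {v, v+1}, {}\<close> or \<open>{v}, {v+1, v+2} \<rightarrow> {v, v+1}, {v+2}\<close> decreases the distance of \<open>c\<close> and
  \<open>c'\<close>, and symmetrically. If no such move applies, the sign of \<open>c' - c\<close> alternates along the whole
  cycle, and exchanging the two perfect matchings, a move of degree \<open>k\<close>, decreases the distance.

  Conversely the two perfect matchings form a complete fibre and have no common factor, so the
  binomials of degree below \<open>k\<close> lie in the ideal of polynomials none of whose monomials divides the
  first matching, whereas the difference of the matchings does not.\<close>

section \<open>Toric ideals of monomial maps\<close>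

lemma mpoly_ring_simps [simp]:
  "p \<in> carrier (mpoly_ring X) \<longleftrightarrow> (\<forall>m \<in> Poly_Mapping.keys p. Poly_Mapping.keys m \<subseteq> X)"
  "p \<otimes>\<^bsub>mpoly_ring X\<^esub> q = p * q"
  "\<one>\<^bsub>mpoly_ring X\<^esub> = 1"
  "\<zero>\<^bsub>mpoly_ring X\<^esub> = 0"
  "p \<oplus>\<^bsub>mpoly_ring X\<^esub> q = p + q"
  by (simp_all add: mpoly_ring_def)

lemma a_minus_mpoly_ring:
  assumes "q \<in> carrier (mpoly_ring X)"
  shows "p \<ominus>\<^bsub>mpoly_ring X\<^esub> q = p - (q :: ('x, 'k::field) mpoly)"
proof -
  interpret cring "mpoly_ring X :: ('x, 'k) mpoly ring"
    by (rule cring_mpoly_ring)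
  have "\<ominus>\<^bsub>mpoly_ring X\<^esub> q = - q"
    using assms by (intro minus_equality) auto
  then show ?thesis
    by (simp add: a_minus_def)
qed

text \<open>The degree of a monomial in which the variable \<open>x\<close> has degree
  \<open>F x\<close>. The total degree, the exponents of an image monomial and the number of cliques
  covering a vertex are all of this form.\<close>

definition weight :: "('x \<Rightarrow> nat) \<Rightarrow> ('x \<Rightarrow>\<^sub>0 nat) \<Rightarrow> nat" where
  "weight F m = (\<Sum>x \<in> Poly_Mapping.keys m. Poly_Mapping.lookup m x * F x)"

lemma weight_eq_sum:
  assumes "finite A" "Poly_Mapping.keys m \<subseteq> A"
  shows "weight F m = (\<Sum>x \<in> A. Poly_Mapping.lookup m x * F x)"
  unfolding weight_def
  by (rule sum.mono_neutral_left) (use assms in \<open>auto simp: in_keys_iff\<close>)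

lemma weight_add: "weight F (a + b) = weight F a + weight F b"
proof -
  let ?A = "Poly_Mapping.keys a \<union> Poly_Mapping.keys b"
  have *: "weight F c = (\<Sum>x \<in> ?A. Poly_Mapping.lookup c x * F x)"
    if "Poly_Mapping.keys c \<subseteq> ?A" for c
    using that by (intro weight_eq_sum) auto
  show ?thesis
    using *[of a] *[of b] *[of "a + b"] Poly_Mapping.keys_add[of a b]
    by (simp add: lookup_add distrib_right sum.distrib)
qed

lemma weight_cong:
  "(\<And>x. x \<in> Poly_Mapping.keys m \<Longrightarrow> F x = F' x) \<Longrightarrow> weight F m = weight F' m"
  by (simp add: weight_def)

lemma weight_add_fun: "weight (\<lambda>x. F x + F' x) m = weight F m + weight F' m"
  by (simp add: weight_def distrib_left sum.distrib)

lemma weight_zero [simp]: "weight F 0 = 0"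
  by (simp add: weight_def)

lemma weight_single [simp]: "weight F (Poly_Mapping.single x c) = c * F x"
  by (subst weight_eq_sum[of "{x}"]) auto

lemma monom_degree_eq_weight: "monom_degree m = weight (\<lambda>_. 1) m"
  by (simp add: monom_degree_def weight_def)

text \<open>The exponent vector of the image of the monomial \<open>m\<close> when every variable
  \<open>x\<close> is sent to the monomial \<open>g x\<close>. The inner sum is repeated addition,
  which \<open>mpoly_monom_sum\<close> turns into a power.\<close>

definition monom_image :: "('x \<Rightarrow> ('y \<Rightarrow>\<^sub>0 nat)) \<Rightarrow> ('x \<Rightarrow>\<^sub>0 nat) \<Rightarrow> ('y \<Rightarrow>\<^sub>0 nat)" where
  "monom_image g m = (\<Sum>x \<in> Poly_Mapping.keys m. \<Sum>i < Poly_Mapping.lookup m x. g x)"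

lemma lookup_monom_image:
  "Poly_Mapping.lookup (monom_image g m) y = weight (\<lambda>x. Poly_Mapping.lookup (g x) y) m"
  by (simp add: monom_image_def weight_def lookup_sum)

lemma monom_image_add: "monom_image g (a + b) = monom_image g a + monom_image g b"
  by (rule poly_mapping_eqI) (simp add: lookup_monom_image lookup_add weight_add)

lemma mpoly_monom_mult: "mpoly_monom a * mpoly_monom b = mpoly_monom (a + b)"
  by (simp add: mpoly_monom_def mult_single)

lemma mpoly_monom_0: "mpoly_monom 0 = 1"
  by (simp add: mpoly_monom_def)

lemma mpoly_monom_sum: "mpoly_monom (\<Sum>i\<in>A. f i) = (\<Prod>i\<in>A. mpoly_monom (f i))"
  by (induction A rule: infinite_finite_induct) (auto simp: mpoly_monom_0 simp flip: mpoly_monom_mult)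

lemma mpoly_subst_monom_single:
  fixes g :: "'x \<Rightarrow> ('y \<Rightarrow>\<^sub>0 nat)"
  shows "mpoly_subst (\<lambda>x. mpoly_monom (g x)) (Poly_Mapping.single m c) =
   Poly_Mapping.single (monom_image g m) (c :: 'k::field)"
proof -
  have "(\<Prod>x\<in>Poly_Mapping.keys m. mpoly_monom (g x) ^ Poly_Mapping.lookup m x)
      = (mpoly_monom (monom_image g m) :: ('y, 'k) mpoly)"
    by (simp add: monom_image_def mpoly_monom_sum)
  then show ?thesis
    unfolding mpoly_subst_single by (simp add: mpoly_const_def mpoly_monom_def mult_single)
qed

lemma keys_mpoly_monom [simp]:
  "Poly_Mapping.keys (mpoly_monom m :: ('x, 'k::field) mpoly) = {m}"
  by (simp add: mpoly_monom_def)

lemma keys_mpoly_monom_diff: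
  assumes "m \<noteq> m'"
  shows "Poly_Mapping.keys (mpoly_monom m - mpoly_monom m' :: ('x, 'k::field) mpoly) = {m, m'}"
  using assms by (auto simp: mpoly_monom_def in_keys_iff lookup_minus lookup_single when_def split: if_splits)

lemma total_degree_monom_diff:
  assumes "m \<noteq> m'"
  shows "total_degree (mpoly_monom m - mpoly_monom m' :: ('x, 'k::field) mpoly) =
    max (monom_degree m) (monom_degree m')"
  using assms by (simp add: total_degree_def keys_mpoly_monom_diff)

lemma mpoly_subst_minus: "mpoly_subst f (p - q) = mpoly_subst f p - mpoly_subst f q"
  using mpoly_subst_add[of f "p - q" q] by (simp add: eq_diff_eq)

lemma mpoly_subst_monom_diff:
  "mpoly_subst (\<lambda>x. mpoly_monom (g x)) (mpoly_monom m - mpoly_monom m' :: ('x, 'k::field) mpoly) = 0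
    \<longleftrightarrow> monom_image g m = monom_image g m'"
proof -
  have "mpoly_subst (\<lambda>x. mpoly_monom (g x)) (mpoly_monom m - mpoly_monom m' :: ('x, 'k) mpoly)
     = mpoly_monom (monom_image g m) - mpoly_monom (monom_image g m')"
    using mpoly_subst_monom_single[of g m "1::'k"] mpoly_subst_monom_single[of g m' "1::'k"]
    by (simp add: mpoly_subst_minus mpoly_monom_def[of m] mpoly_monom_def[of m']
        mpoly_monom_def[of "monom_image g m"] mpoly_monom_def[of "monom_image g m'"])
  also have "\<dots> = 0 \<longleftrightarrow> monom_image g m = monom_image g m'"
    using keys_mpoly_monom_diff[of "monom_image g m" "monom_image g m'", where 'k = 'k]
    by (metis empty_not_insert keys_zero cancel_comm_monoid_add_class.diff_cancel)
  finally show ?thesis .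
qed

text \<open>Terms can cancel only within a fibre of \<open>monom_image g\<close>, so a nonzero
  polynomial of the kernel has two monomials in one fibre. Subtracting a multiple of their
  difference, which lies in \<open>J\<close>, shrinks the support.\<close>

lemma monomial_map_kernel_subset:
  fixes g :: "'x \<Rightarrow> ('y \<Rightarrow>\<^sub>0 nat)" and p :: "('x, 'k::field) mpoly"
  assumes J: "ideal J (mpoly_ring X)"
    and fib: "\<And>m m'. Poly_Mapping.keys m \<subseteq> X \<Longrightarrow> Poly_Mapping.keys m' \<subseteq> X \<Longrightarrow>
      monom_image g m = monom_image g m' \<Longrightarrow> mpoly_monom m - mpoly_monom m' \<in> J"
    and "p \<in> carrier (mpoly_ring X)" "mpoly_subst (\<lambda>x. mpoly_monom (g x)) p = 0"
  shows "p \<in> J"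
  using assms(3,4)
proof (induction "card (Poly_Mapping.keys p)" arbitrary: p rule: less_induct)
  case less
  interpret ideal J "mpoly_ring X" by (rule J)
  let ?S = "mpoly_subst (\<lambda>x. mpoly_monom (g x)) :: ('x, 'k) mpoly \<Rightarrow> _"
  show ?case
  proof (cases "p = 0")
    case True
    then show ?thesis using additive_subgroup.zero_closed[OF is_additive_subgroup] by simp
  next
    case False
    then obtain m where m: "m \<in> Poly_Mapping.keys p"
      by fastforce
    define c where "c = Poly_Mapping.lookup p m"
    have "\<exists>m' \<in> Poly_Mapping.keys p. m' \<noteq> m \<and> monom_image g m' = monom_image g m"
    proof (rule ccontr)
      assume no: "\<not> ?thesis"
      have "?S p = (\<Sum>a \<in> Poly_Mapping.keys p. Poly_Mapping.single (monom_image g a) (Poly_Mapping.lookup p a))"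
        unfolding mpoly_subst_def[of _ p]
        by (simp add: mpoly_subst_monom_single flip: mpoly_subst_single)
      then have "Poly_Mapping.lookup (?S p) (monom_image g m)
        = (\<Sum>a \<in> Poly_Mapping.keys p. if a = m then c else 0)"
        unfolding lookup_sum using no
        by (auto simp: lookup_sum lookup_single when_def c_def intro!: sum.cong simp del: sum.delta)
      also have "\<dots> = c" using m by simp
      finally show False using less.prems(2) m by (simp add: c_def in_keys_iff)
    qed
    then obtain m' where m': "m' \<in> Poly_Mapping.keys p" "m' \<noteq> m" "monom_image g m' = monom_image g m"
      by blast
    define b where "b = mpoly_const c * (mpoly_monom m - mpoly_monom m' :: ('x, 'k) mpoly)"
    have bJ: "b \<in> J"
      unfolding b_def
      using I_l_closed[OF fib[of m m'], of "mpoly_const c"] less.prems(1) m m'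
      by (auto simp: mpoly_const_def)
    have lb: "Poly_Mapping.lookup b a = (if a = m then c else if a = m' then - c else 0)" for a
      using m'(2) by (simp add: b_def mpoly_const_def mpoly_monom_def right_diff_distrib mult_single
          lookup_minus lookup_single when_def)
    \<comment> \<open>Subtracting \<open>b\<close> cancels \<open>m\<close> and otherwise changes
      only the coefficient at \<open>m'\<close>, which already belongs to the support of
      \<open>p\<close>.\<close>
    have sub: "Poly_Mapping.keys (p - b) \<subseteq> Poly_Mapping.keys p - {m}"
      using m m' by (auto simp: in_keys_iff lookup_minus lb c_def split: if_splits)
    have "?S b = 0"
      using mpoly_subst_monom_diff[of g m m', where 'k = 'k] m'(3) by (simp add: b_def mpoly_subst_mult)
    then have "?S (p - b) = 0"
      using less.prems(2) by (simp add: mpoly_subst_minus)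
    moreover have "card (Poly_Mapping.keys (p - b)) < card (Poly_Mapping.keys p)"
      using psubset_card_mono[of "Poly_Mapping.keys p" "Poly_Mapping.keys (p - b)"] sub m by auto
    moreover have "p - b \<in> carrier (mpoly_ring X)"
      using less.prems(1) sub by auto
    ultimately have "p - b \<in> J"
      using less.hyps by blast
    then show ?thesis
      using additive_subgroup.a_closed[OF is_additive_subgroup _ bJ, of "p - b"] by simp
  qed
qed

section \<open>Homomorphism ideals as kernels of monomial maps\<close>

definition edge_monom :: "'v ugraph \<Rightarrow> ('v \<Rightarrow> 'w) \<Rightarrow> ('v set \<times> ('v \<Rightarrow> 'w) \<Rightarrow>\<^sub>0 nat)" where
  "edge_monom G \<phi> = (\<Sum>e \<in> edges G. Poly_Mapping.single (e, restrict \<phi> e) 1)"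

text \<open>Brings \<open>Phi_map\<close> into the form of a monomial map, so that its kernel is
  governed by the fibres of \<open>monom_image (edge_monom G)\<close>.\<close>

lemma Phi_map_eq: "Phi_map G = mpoly_subst (\<lambda>\<phi>. mpoly_monom (edge_monom G \<phi>))"
  by (simp add: Phi_map_def edge_monom_def mpoly_monom_sum mpoly_var_def)

lemma lookup_edge_monom:
  assumes "finite (edges G)"
  shows "Poly_Mapping.lookup (edge_monom G \<phi>) (e, \<psi>) = of_bool (e \<in> edges G \<and> \<psi> = restrict \<phi> e)"
proof -
  have "Poly_Mapping.lookup (edge_monom G \<phi>) (e, \<psi>) =
    (\<Sum>e' \<in> edges G. if e' = e then of_bool (\<psi> = restrict \<phi> e) else 0)"
    unfolding edge_monom_def lookup_sum
    by (intro sum.cong) (auto simp: lookup_single when_def)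
  then show ?thesis using assms by simp
qed

lemma toric_ideal_iff:
  "p \<in> toric_ideal G H \<longleftrightarrow> p \<in> carrier (R_ring G H) \<and> Phi_map G p = 0"
  by (simp add: toric_ideal_def a_kernel_def' del: mpoly_ring_simps(1))

lemma ideal_toric_ideal:
  assumes "finite_graph G"
  shows "ideal (toric_ideal G H) (R_ring G H :: ('v \<Rightarrow> 'w, 'k::field) mpoly ring)"
proof -
  interpret ring_hom_ring "R_ring G H :: ('v \<Rightarrow> 'w, 'k) mpoly ring" "S_ring G H" "Phi_map G"
    by (intro ring_hom_ringI2 cring.axioms(1)[OF cring_mpoly_ring]
        Phi_map_ring_hom[OF assms])
  show ?thesis unfolding toric_ideal_def by (rule kernel_is_ideal)
qed

lemma monom_diff_in_binomials_upto:
  assumes "Poly_Mapping.keys u \<subseteq> graph_homs G H" "Poly_Mapping.keys u' \<subseteq> graph_homs G H"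
    and "monom_image (edge_monom G) u = monom_image (edge_monom G) u'"
    and "monom_degree u \<le> d" "monom_degree u' \<le> d"
  shows "(mpoly_monom u - mpoly_monom u' :: ('v \<Rightarrow> 'w, 'k::field) mpoly)
    \<in> binomials_upto (toric_ideal G H) d"
\<comment> \<open>The support and degree formulas for a difference of monomials need distinct
  monomials; if the two coincide, the binomial is zero.\<close>
proof (cases "u = u'")
  case True
  then show ?thesis
    unfolding binomials_upto_def toric_ideal_iff
    by (auto simp: Phi_map_eq mpoly_subst_zero total_degree_def)
next
  case False
  then show ?thesis
    using assms mpoly_subst_monom_diff[of "edge_monom G" u u', where 'k = 'k]
    unfolding binomials_upto_def toric_ideal_iff
    by (auto simp: Phi_map_eq keys_mpoly_monom_diff total_degree_monom_diff)
qed

lemma keys_add_subset: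
  "Poly_Mapping.keys a \<subseteq> A \<Longrightarrow> Poly_Mapping.keys b \<subseteq> A \<Longrightarrow> Poly_Mapping.keys (a + b) \<subseteq> A"
  for a b :: "'x \<Rightarrow>\<^sub>0 nat"
  using Poly_Mapping.keys_add[of a b] by blast

lemma keys_two_singles:
  assumes "x \<in> A" "y \<in> A"
  shows "Poly_Mapping.keys (Poly_Mapping.single x 1 + Poly_Mapping.single y (1 :: nat)) \<subseteq> A"
  by (rule keys_add_subset) (use assms in auto)

lemma monom_degree_add: "monom_degree (a + b) = monom_degree a + monom_degree b"
  by (simp add: monom_degree_eq_weight weight_add)

lemma monom_degree_single: "monom_degree (Poly_Mapping.single x i) = i"
  by (simp add: monom_degree_eq_weight)

lemma binomials_upto_subset: "binomials_upto (toric_ideal G H) d \<subseteq> carrier (R_ring G H)"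
  by (auto simp: binomials_upto_def toric_ideal_iff simp del: mpoly_ring_simps(1))

lemma ideal_low_binomials:
  "ideal (Idl\<^bsub>R_ring G H\<^esub> (binomials_upto (toric_ideal G H) d)) (R_ring G H :: (_, 'k::field) mpoly ring)"
proof -
  interpret cring "R_ring G H :: (_, 'k) mpoly ring" by (rule cring_mpoly_ring)
  show ?thesis by (rule genideal_ideal[OF binomials_upto_subset])
qed

text \<open>The equation \<open>u + v = m0\<close> says that \<open>u\<close> divides
  \<open>m0\<close>. Factors of divisors are divisors, so multiplying a polynomial supported on
  nondivisors of \<open>m0\<close> creates no divisor of \<open>m0\<close>. This ideal serves for
  the lower bound.\<close>

lemma ideal_nondivisors:
  "ideal {q \<in> carrier (mpoly_ring X). \<forall>u v. u + v = m0 \<longrightarrow> Poly_Mapping.lookup q u = 0}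
    (mpoly_ring X :: ('x, 'k::field) mpoly ring)"
proof -
  interpret cring "mpoly_ring X :: ('x, 'k) mpoly ring" by (rule cring_mpoly_ring)
  let ?K = "{q \<in> carrier (mpoly_ring X). \<forall>u v. u + v = m0 \<longrightarrow> Poly_Mapping.lookup q u = 0}
    :: ('x, 'k) mpoly set"
  have mult: "x * q \<in> ?K" if q: "q \<in> ?K" and x: "x \<in> carrier (mpoly_ring X)" for q x
  proof -
    have "Poly_Mapping.lookup (x * q) u = 0" if uv: "u + v = m0" for u v
    proof (rule ccontr)
      assume "Poly_Mapping.lookup (x * q) u \<noteq> 0"
      then have "u \<in> Poly_Mapping.keys (x * q)" by (simp add: in_keys_iff)
      then obtain s t where st: "u = s + t" "t \<in> Poly_Mapping.keys q"
        using keys_mult[of x q] by blast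
      have "t + (s + v) = m0" using uv st(1) by (simp add: ac_simps)
      then show False using q st(2) by (auto simp: in_keys_iff)
    qed
    moreover have "x * q \<in> carrier (mpoly_ring X)"
      using m_closed[of x q] q x by (simp del: mpoly_ring_simps(1))
    ultimately show ?thesis by blast
  qed
  have "subgroup ?K (add_monoid (mpoly_ring X))"
  proof (rule group.subgroupI)
    show "Group.group (add_monoid (mpoly_ring X :: ('x, 'k) mpoly ring))"
      by (rule a_group)
    show "?K \<noteq> {}" by (auto intro!: exI[of _ 0])
    fix x assume x: "x \<in> ?K"
    show "inv\<^bsub>add_monoid (mpoly_ring X)\<^esub> x \<in> ?K"
      using a_minus_mpoly_ring[of x X 0] x l_zero[of "\<ominus>\<^bsub>mpoly_ring X\<^esub> x"] a_inv_closed[of x]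
      by (auto simp: a_minus_def a_inv_def)
    fix y assume y: "y \<in> ?K"
    show "x \<otimes>\<^bsub>add_monoid (mpoly_ring X)\<^esub> y \<in> ?K"
      using x y a_closed[of x y] by (simp add: lookup_add del: mpoly_ring_simps(1))
  qed auto
  then show ?thesis
    by (intro idealI ring_axioms) (use mult in \<open>auto simp: mult.commute simp del: mpoly_ring_simps(1)\<close>)
qed

section \<open>Homomorphisms from the complement of an even cycle\<close>

lemma mod_Suc_cycle: "i < n \<Longrightarrow> (i + 1) mod n = (if i + 1 = n then 0 else i + 1)" for i n :: nat
  by auto

text \<open>The value 1 is the unlooped vertex of \<open>Lambda_graph\<close>, so \<open>A\<close>
  is the independent set belonging to the map. The restriction makes the map extensional, as
  \<open>graph_homs\<close> demands.\<close>

definition indicator_map :: "nat \<Rightarrow> nat set \<Rightarrow> nat \<Rightarrow> nat" where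
  "indicator_map n A = restrict (\<lambda>v. of_bool (v \<in> A)) {..<n}"

lemma indicator_map_eq_iff:
  assumes "A \<subseteq> {..<n}" "B \<subseteq> {..<n}"
  shows "indicator_map n A = indicator_map n B \<longleftrightarrow> A = B"
proof
  assume eq: "indicator_map n A = indicator_map n B"
  have "v \<in> A \<longleftrightarrow> v \<in> B" if "v < n" for v
    using fun_cong[OF eq, of v] that by (simp add: indicator_map_def of_bool_def split: if_splits)
  then show "A = B" using assms by auto
qed simp

context
  fixes k :: nat
  assumes k2: "k \<ge> 2"
begin

abbreviation "cyc_succ i \<equiv> (i + 1) mod (2 * k)"
definition "cyc_pred v = (if v = 0 then 2 * k - 1 else v - 1)"

abbreviation "cocycle \<equiv> complement_graph (cycle_graph (2 * k))"
abbreviation "cocycle_image \<equiv>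
  monom_image (edge_monom cocycle) :: ((nat \<Rightarrow> nat) \<Rightarrow>\<^sub>0 nat) \<Rightarrow> _"
abbreviation "cocycle_homs \<equiv> graph_homs cocycle Lambda_graph"

definition "hom_empty = indicator_map (2 * k) {}"
definition "hom_vertex v = indicator_map (2 * k) {v}"
definition "hom_edge i = indicator_map (2 * k) {i, cyc_succ i}"

lemma cyc_succ_neq: "i < 2 * k \<Longrightarrow> cyc_succ i \<noteq> i"
  using k2 by (simp only: mod_Suc_cycle) auto

lemma cyc_succ_less: "cyc_succ i < 2 * k"
  using k2 by simp

lemma cyc_pred_less: "v < 2 * k \<Longrightarrow> cyc_pred v < 2 * k"
  by (auto simp: cyc_pred_def)

lemma cyc_succ_pred: "v < 2 * k \<Longrightarrow> cyc_succ (cyc_pred v) = v"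
  using k2 by (auto simp: cyc_pred_def)

lemma cyc_pred_succ: "v < 2 * k \<Longrightarrow> cyc_pred (cyc_succ v) = v"
  using k2 by (simp only: mod_Suc_cycle) (auto simp: cyc_pred_def)

lemma edges_cycle_iff:
  assumes "u < 2 * k" "v < 2 * k"
  shows "{u, v} \<in> edges (cycle_graph (2 * k)) \<longleftrightarrow> v = cyc_succ u \<or> u = cyc_succ v"
  using assms by (auto simp: cycle_graph_def doubleton_eq_iff)

lemma edges_cocycle_iff:
  "{u, v} \<in> edges cocycle \<longleftrightarrow>
    u < 2 * k \<and> v < 2 * k \<and> u \<noteq> v \<and> v \<noteq> cyc_succ u \<and> u \<noteq> cyc_succ v"
proof -
  have "{u, v} \<in> edges cocycle \<longleftrightarrow>
    u < 2 * k \<and> v < 2 * k \<and> u \<noteq> v \<and> {u, v} \<notin> edges (cycle_graph (2 * k))"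
    by (auto simp: complement_graph_def cycle_graph_def doubleton_eq_iff)
  then show ?thesis using edges_cycle_iff[of u v] by blast
qed

lemma edges_cocycleE:
  assumes "e \<in> edges cocycle"
  obtains u v where "e = {u, v}"
  using assms by (auto simp: complement_graph_def)

text \<open>The loop at 1 is the only pair missing from the edges of
  \<open>Lambda_graph\<close>.\<close>

lemma cocycle_homs_iff:
  "\<phi> \<in> cocycle_homs \<longleftrightarrow> \<phi> \<in> {..<2 * k} \<rightarrow>\<^sub>E {0, 1} \<and>
    (\<forall>u v. {u, v} \<in> edges cocycle \<longrightarrow> \<phi> u = 0 \<or> \<phi> v = 0)"
proof -
  have *: "{x, y} \<in> edges Lambda_graph \<longleftrightarrow> x = 0 \<or> y = 0" if "x \<in> {0, 1}" "y \<in> {0, 1}" for x y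
    using that by (auto simp: Lambda_graph_def)
  have "verts cocycle = {..<2 * k}" "verts Lambda_graph = {0, 1}"
    by (auto simp: complement_graph_def cycle_graph_def Lambda_graph_def)
  then show ?thesis
    unfolding graph_homs_def mem_Collect_eq
    using * edges_cocycle_iff by (metis PiE_mem lessThan_iff)
qed

lemma hom_empty_apply: "v < 2 * k \<Longrightarrow> hom_empty v = 0"
  by (simp add: hom_empty_def indicator_map_def)

lemma hom_vertex_apply: "w < 2 * k \<Longrightarrow> hom_vertex v w = of_bool (w = v)"
  by (simp add: hom_vertex_def indicator_map_def)

lemma hom_edge_apply:
  "i < 2 * k \<Longrightarrow> w < 2 * k \<Longrightarrow> hom_edge i w = of_bool (w = i) + of_bool (w = cyc_succ i)"
  using cyc_succ_neq[of i] by (auto simp: hom_edge_def indicator_map_def)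

text \<open>This uses \<open>k2\<close>: on two vertices the edges starting at 0 and at 1 would be
  the same set.\<close>

lemma cyc_edges_eq_iff:
  assumes "i < 2 * k" "j < 2 * k"
  shows "{i, cyc_succ i} = {j, cyc_succ j} \<longleftrightarrow> i = j"
  using assms k2 by (simp only: mod_Suc_cycle doubleton_eq_iff) auto

lemma hom_distinct:
  "i < 2 * k \<Longrightarrow> j < 2 * k \<Longrightarrow> hom_edge i = hom_edge j \<longleftrightarrow> i = j"
  "i < 2 * k \<Longrightarrow> j < 2 * k \<Longrightarrow> hom_vertex i = hom_vertex j \<longleftrightarrow> i = j"
  "i < 2 * k \<Longrightarrow> j < 2 * k \<Longrightarrow> hom_edge i \<noteq> hom_vertex j"
  "i < 2 * k \<Longrightarrow> j < 2 * k \<Longrightarrow> hom_vertex j \<noteq> hom_edge i"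
  "i < 2 * k \<Longrightarrow> hom_edge i \<noteq> hom_empty"
  "i < 2 * k \<Longrightarrow> hom_vertex i \<noteq> hom_empty"
  "i < 2 * k \<Longrightarrow> hom_empty \<noteq> hom_edge i"
  "i < 2 * k \<Longrightarrow> hom_empty \<noteq> hom_vertex i"
  using cyc_succ_neq[of i] cyc_succ_less[of i] cyc_succ_less[of j] cyc_edges_eq_iff[of i j]
  by (simp_all add: hom_edge_def hom_vertex_def hom_empty_def indicator_map_eq_iff del: mod_less)
    (metis doubleton_eq_iff insert_absorb2)+

text \<open>The preimage of 1 is independent in the complement, hence a clique of the cycle. A cycle
  of length at least 4 has no triangle, so the clique has at most two vertices.\<close>

lemma cocycle_homs_eq:
  "cocycle_homs = insert hom_empty (hom_vertex ` {..<2 * k} \<union> hom_edge ` {..<2 * k})"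
proof (intro equalityI subsetI)
  fix \<phi> assume \<phi>: "\<phi> \<in> cocycle_homs"
  define A where "A = {v \<in> {..<2 * k}. \<phi> v = 1}"
  have \<phi>A: "\<phi> = indicator_map (2 * k) A"
    using \<phi> unfolding cocycle_homs_iff
    by (intro ext) (auto simp: indicator_map_def A_def PiE_iff extensional_def)
  have adj: "v = cyc_succ u \<or> u = cyc_succ v" if "u \<in> A" "v \<in> A" "u \<noteq> v" for u v
    using \<phi> that unfolding cocycle_homs_iff edges_cocycle_iff A_def by force
  have A: "A \<subseteq> {..<2 * k}" by (auto simp: A_def)
  consider "A = {}" | v where "A = {v}" | i where "i \<in> A" "cyc_succ i \<in> A"
    using adj by (metis insertI1 is_singletonI' is_singleton_def)
  then show "\<phi> \<in> insert hom_empty (hom_vertex ` {..<2 * k} \<union> hom_edge ` {..<2 * k})"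
  proof cases
    case 1
    then show ?thesis by (simp add: \<phi>A hom_empty_def)
  next
    case (2 v)
    then show ?thesis using A by (simp add: \<phi>A hom_vertex_def)
  next
    case (3 i)
    have i: "i < 2 * k" using 3 A by auto
    have "w = i \<or> w = cyc_succ i" if w: "w \<in> A" for w
    proof (rule ccontr)
      assume ne: "\<not> (w = i \<or> w = cyc_succ i)"
      have w': "w < 2 * k" using w A by auto
      have "i = cyc_succ w" using adj[OF w 3(1)] ne by auto
      moreover have "w = cyc_succ (cyc_succ i)"
        using adj[OF w 3(2)] ne cyc_pred_succ[OF w'] cyc_pred_succ[OF i] by metis
      \<comment> \<open>A third vertex \<open>w\<close> closes a triangle, so three successor steps
        from \<open>i\<close> return to \<open>i\<close>. No cycle of even length at least 4 allows
        this.\<close>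
      ultimately show False
        using k2 i w' cyc_succ_less[of i] by (simp only: mod_Suc_cycle split: if_splits)
    qed
    then have "A = {i, cyc_succ i}" using 3 by auto
    then show ?thesis using i by (simp add: \<phi>A hom_edge_def)
  qed
next
  fix \<phi> assume "\<phi> \<in> insert hom_empty (hom_vertex ` {..<2 * k} \<union> hom_edge ` {..<2 * k})"
  then obtain A where A: "\<phi> = indicator_map (2 * k) A" and
    "A = {} \<or> (\<exists>v. A = {v}) \<or> (\<exists>i<2 * k. A = {i, cyc_succ i})"
    by (auto simp: hom_empty_def hom_vertex_def hom_edge_def)
  then have "u \<in> A \<Longrightarrow> v \<in> A \<Longrightarrow> u \<noteq> v \<Longrightarrow> v = cyc_succ u \<or> u = cyc_succ v" for u v
    by auto
  then show "\<phi> \<in> cocycle_homs"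
    unfolding cocycle_homs_iff edges_cocycle_iff A
    by (auto simp: indicator_map_def)
qed

section \<open>Clique multiplicities and the fibres of the monomial map\<close>

abbreviation "n_empty m \<equiv> Poly_Mapping.lookup (m :: (nat \<Rightarrow> nat) \<Rightarrow>\<^sub>0 nat) hom_empty"
abbreviation "n_vertex m i \<equiv> Poly_Mapping.lookup (m :: (nat \<Rightarrow> nat) \<Rightarrow>\<^sub>0 nat) (hom_vertex i)"
abbreviation "n_edge m i \<equiv> Poly_Mapping.lookup (m :: (nat \<Rightarrow> nat) \<Rightarrow>\<^sub>0 nat) (hom_edge i)"

lemma weight_cocycle:
  assumes "Poly_Mapping.keys m \<subseteq> cocycle_homs"
  shows "weight F m = n_empty m * F hom_empty
    + (\<Sum>i<2 * k. n_vertex m i * F (hom_vertex i)) + (\<Sum>i<2 * k. n_edge m i * F (hom_edge i))"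
proof -
  have inj: "inj_on hom_vertex {..<2 * k}" "inj_on hom_edge {..<2 * k}"
    by (auto simp: inj_on_def hom_distinct)
  have "weight F m = (\<Sum>x \<in> cocycle_homs. Poly_Mapping.lookup m x * F x)"
    using assms by (intro weight_eq_sum) (auto simp: cocycle_homs_eq)
  also have "\<dots> = n_empty m * F hom_empty + (\<Sum>x \<in> hom_vertex ` {..<2 * k}. Poly_Mapping.lookup m x * F x)
    + (\<Sum>x \<in> hom_edge ` {..<2 * k}. Poly_Mapping.lookup m x * F x)"
    unfolding cocycle_homs_eq
    by (subst sum.insert; (subst sum.union_disjoint)?) (auto simp: hom_distinct)
  finally show ?thesis
    by (simp add: sum.reindex[OF inj(1)] sum.reindex[OF inj(2)])
qed

lemma degree_cocycle:
  assumes "Poly_Mapping.keys m \<subseteq> cocycle_homs"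
  shows "monom_degree m = n_empty m + (\<Sum>i<2 * k. n_vertex m i) + (\<Sum>i<2 * k. n_edge m i)"
  using weight_cocycle[OF assms, of "\<lambda>_. 1"] by (simp add: monom_degree_eq_weight)

text \<open>A vertex is covered by its singleton and by the two cycle edges through it. Stating this
  at \<open>cyc_succ i\<close> gives these edges the indices \<open>i\<close> and
  \<open>cyc_succ i\<close>, with no predecessor involved.\<close>

lemma weight_vertex:
  assumes "Poly_Mapping.keys m \<subseteq> cocycle_homs" "i < 2 * k"
  shows "weight (\<lambda>\<phi>. \<phi> (cyc_succ i)) m = n_vertex m (cyc_succ i) + n_edge m (cyc_succ i) + n_edge m i"
proof -
  let ?s = "cyc_succ i"
  have s: "?s < 2 * k" by (rule cyc_succ_less)
  have eq: "?s = cyc_succ j \<longleftrightarrow> j = i" if "j < 2 * k" for j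
    using cyc_pred_succ that assms(2) by metis
  have "(\<Sum>j<2 * k. n_vertex m j * hom_vertex j ?s) = (\<Sum>j<2 * k. if j = ?s then n_vertex m ?s else 0)"
    using s by (intro sum.cong) (auto simp: hom_vertex_apply)
  moreover have "(\<Sum>j<2 * k. n_edge m j * hom_edge j ?s) =
    (\<Sum>j<2 * k. (if j = ?s then n_edge m ?s else 0) + (if j = i then n_edge m i else 0))"
    using s eq by (intro sum.cong) (auto simp: hom_edge_apply)
  ultimately show ?thesis
    using s assms(2) by (simp add: weight_cocycle[OF assms(1)] hom_empty_apply sum.distrib)
qed

lemma cocycle_monom_eqI:
  assumes "Poly_Mapping.keys m \<subseteq> cocycle_homs" "Poly_Mapping.keys m' \<subseteq> cocycle_homs"
    and "n_empty m = n_empty m'" "\<And>i. i < 2 * k \<Longrightarrow> n_vertex m i = n_vertex m' i"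
    "\<And>i. i < 2 * k \<Longrightarrow> n_edge m i = n_edge m' i"
  shows "m = m'"
proof (rule poly_mapping_eqI)
  fix \<phi>
  show "Poly_Mapping.lookup m \<phi> = Poly_Mapping.lookup m' \<phi>"
  proof (cases "\<phi> \<in> cocycle_homs")
    case True
    then show ?thesis using assms(3-5) by (auto simp: cocycle_homs_eq)
  next
    case False
    then show ?thesis using assms(1,2) by (metis in_keys_iff subsetD)
  qed
qed

text \<open>An edge of the complement meets a clique of the cycle in at most one endpoint. So a
  restriction to it shows one of three patterns: first endpoint, second endpoint, or
  neither.\<close>

lemma restrict_cocycle_hom:
  assumes "\<phi> \<in> cocycle_homs" "{u, v} \<in> edges cocycle"
  shows "restrict (hom_vertex u) {u, v} = restrict \<phi> {u, v} \<longleftrightarrow> \<phi> u = 1"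
    and "restrict hom_empty {u, v} = restrict \<phi> {u, v} \<longleftrightarrow> \<phi> u = 0 \<and> \<phi> v = 0"
proof -
  have "\<phi> u = 0 \<or> \<phi> u = 1" "\<phi> v = 0 \<or> \<phi> v = 1" "\<phi> u = 0 \<or> \<phi> v = 0" "u < 2 * k" "v < 2 * k" "u \<noteq> v"
    using assms unfolding cocycle_homs_iff edges_cocycle_iff by (auto simp: PiE_iff)
  then show "restrict (hom_vertex u) {u, v} = restrict \<phi> {u, v} \<longleftrightarrow> \<phi> u = 1"
    and "restrict hom_empty {u, v} = restrict \<phi> {u, v} \<longleftrightarrow> \<phi> u = 0 \<and> \<phi> v = 0"
    by (auto simp: hom_vertex_apply hom_empty_apply restrict_def fun_eq_iff)
qed

text \<open>For an edge \<open>{u, v}\<close> of the complement the three patterns occur as often as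
  \<open>u\<close> is covered, as \<open>v\<close> is covered, and as the degree minus both.
  Conversely every vertex lies on such an edge, and a single edge recovers the degree.\<close>

lemma same_image_iff:
  assumes m: "Poly_Mapping.keys m \<subseteq> cocycle_homs" and m': "Poly_Mapping.keys m' \<subseteq> cocycle_homs"
  shows "cocycle_image m = cocycle_image m' \<longleftrightarrow>
    monom_degree m = monom_degree m' \<and>
    (\<forall>v<2 * k. weight (\<lambda>\<phi>. \<phi> v) m = weight (\<lambda>\<phi>. \<phi> v) m')"
proof -
  have fin: "finite (edges cocycle)"
    using finite_graph_complement_cycle[of "2 * k"] unfolding finite_graph_def
    by (rule conjE) (erule finite_subset, auto simp: finite_image_set2)
  \<comment> \<open>The exponent of the variable indexed by the edge \<open>e\<close> and the
    pattern \<open>\<psi>\<close> in the image monomial.\<close>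
  define N where "N m e \<psi> = weight (\<lambda>\<phi>. of_bool (\<psi> = restrict \<phi> e)) m"
    for m :: "(nat \<Rightarrow> nat) \<Rightarrow>\<^sub>0 nat" and e :: "nat set" and \<psi>
  have "Poly_Mapping.lookup (monom_image (edge_monom cocycle) m) (e, \<psi>) =
      (if e \<in> edges cocycle then N m e \<psi> else 0)" for m e \<psi>
    by (simp add: lookup_monom_image lookup_edge_monom[OF fin] N_def weight_def)
  then have image: "cocycle_image m = cocycle_image m' \<longleftrightarrow>
      (\<forall>e \<in> edges cocycle. \<forall>\<psi>. N m e \<psi> = N m' e \<psi>)"
    by (auto simp: poly_mapping_eq_iff fun_eq_iff)
  have NV: "N m {u, v} (restrict (hom_vertex u) {u, v}) = weight (\<lambda>\<phi>. \<phi> u) m"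
    if "Poly_Mapping.keys m \<subseteq> cocycle_homs" "{u, v} \<in> edges cocycle" for m u v
    unfolding N_def
  proof (rule weight_cong)
    fix \<phi> assume "\<phi> \<in> Poly_Mapping.keys m"
    then have \<phi>: "\<phi> \<in> cocycle_homs" using that by blast
    then have "\<phi> u = 0 \<or> \<phi> u = 1"
      using that(2) unfolding cocycle_homs_iff edges_cocycle_iff by (auto simp: PiE_iff)
    then show "of_bool (restrict (hom_vertex u) {u, v} = restrict \<phi> {u, v}) = \<phi> u"
      using restrict_cocycle_hom(1)[OF \<phi> that(2)] by auto
  qed
  have NO: "N m {u, v} (restrict hom_empty {u, v}) + weight (\<lambda>\<phi>. \<phi> u) m + weight (\<lambda>\<phi>. \<phi> v) m
      = monom_degree m"
    if "Poly_Mapping.keys m \<subseteq> cocycle_homs" "{u, v} \<in> edges cocycle" for m u v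
    unfolding N_def monom_degree_eq_weight weight_add_fun[symmetric]
  proof (rule weight_cong)
    fix \<phi> assume "\<phi> \<in> Poly_Mapping.keys m"
    then have \<phi>: "\<phi> \<in> cocycle_homs" using that by blast
    then have "\<phi> u = 0 \<or> \<phi> u = 1" "\<phi> v = 0 \<or> \<phi> v = 1" "\<phi> u = 0 \<or> \<phi> v = 0"
      using that(2) unfolding cocycle_homs_iff edges_cocycle_iff by (auto simp: PiE_iff)
    then show "of_bool (restrict hom_empty {u, v} = restrict \<phi> {u, v}) + \<phi> u + \<phi> v = 1"
      using restrict_cocycle_hom(2)[OF \<phi> that(2)] by auto
  qed
  have N0: "N m {u, v} \<psi> = 0"
    if "Poly_Mapping.keys m \<subseteq> cocycle_homs" "{u, v} \<in> edges cocycle"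
      "\<psi> \<noteq> restrict (hom_vertex u) {u, v}" "\<psi> \<noteq> restrict (hom_vertex v) {u, v}"
      "\<psi> \<noteq> restrict hom_empty {u, v}" for m u v \<psi>
  proof -
    have vu: "{v, u} \<in> edges cocycle" using that(2) by (simp add: insert_commute)
    have "\<psi> \<noteq> restrict \<phi> {u, v}" if k: "\<phi> \<in> Poly_Mapping.keys m" for \<phi>
    proof -
      have \<phi>: "\<phi> \<in> cocycle_homs" using k that(1) \<open>Poly_Mapping.keys m \<subseteq> cocycle_homs\<close> by blast
      have "\<phi> u = 0 \<or> \<phi> u = 1" "\<phi> v = 0 \<or> \<phi> v = 1"
        using \<phi> that(1) \<open>{u, v} \<in> edges cocycle\<close> unfolding cocycle_homs_iff edges_cocycle_iff
        by (auto simp: PiE_iff)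
      then show ?thesis
        using restrict_cocycle_hom[OF \<phi> \<open>{u, v} \<in> edges cocycle\<close>] restrict_cocycle_hom[OF \<phi> vu] that
          \<open>\<psi> \<noteq> restrict (hom_vertex u) {u, v}\<close> \<open>\<psi> \<noteq> restrict (hom_vertex v) {u, v}\<close>
          \<open>\<psi> \<noteq> restrict hom_empty {u, v}\<close>
        by (metis insert_commute)
    qed
    then show ?thesis by (simp add: N_def weight_def)
  qed
  show ?thesis
    unfolding image
  proof (intro iffI conjI ballI allI impI)
    assume eq: "\<forall>e \<in> edges cocycle. \<forall>\<psi>. N m e \<psi> = N m' e \<psi>"
    show vert: "weight (\<lambda>\<phi>. \<phi> v) m = weight (\<lambda>\<phi>. \<phi> v) m'" if v: "v < 2 * k" for v
    proof -
      \<comment> \<open>The vertex two steps after \<open>v\<close>, reduced by cases to keep the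
        arithmetic linear. It is not adjacent to \<open>v\<close> on the cycle since the length is
        at least 4.\<close>
      define w where "w = (if v + 2 < 2 * k then v + 2 else v + 2 - 2 * k)"
      have w: "w < 2 * k" using v k2 by (auto simp: w_def)
      have "v \<noteq> w" "w \<noteq> (if v + 1 = 2 * k then 0 else v + 1)" "v \<noteq> (if w + 1 = 2 * k then 0 else w + 1)"
        unfolding w_def using k2 v by presburger+
      then have "{v, w} \<in> edges cocycle"
        using v w unfolding edges_cocycle_iff mod_Suc_cycle[OF v] mod_Suc_cycle[OF w] by blast
      then show ?thesis using NV[OF m] NV[OF m'] eq by metis
    qed
    have E: "{0, 2} \<in> edges cocycle"
      unfolding edges_cocycle_iff using k2 by auto
    have "0 < 2 * k" "2 < 2 * k" using k2 by auto
    then show "monom_degree m = monom_degree m'"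
      using NO[OF m E] NO[OF m' E] eq[rule_format, OF E] vert[of 0] vert[of 2] by simp
  next
    fix e \<psi>
    assume eq: "monom_degree m = monom_degree m' \<and>
        (\<forall>v<2 * k. weight (\<lambda>\<phi>. \<phi> v) m = weight (\<lambda>\<phi>. \<phi> v) m')"
      and e: "e \<in> edges cocycle"
    obtain u v where uv: "e = {u, v}" using e by (rule edges_cocycleE)
    have E: "{u, v} \<in> edges cocycle" "{v, u} \<in> edges cocycle"
      using e uv by (auto simp: insert_commute)
    have W: "weight (\<lambda>\<phi>. \<phi> u) m = weight (\<lambda>\<phi>. \<phi> u) m'" "weight (\<lambda>\<phi>. \<phi> v) m = weight (\<lambda>\<phi>. \<phi> v) m'"
      using eq E(1) unfolding edges_cocycle_iff by auto
    consider "\<psi> = restrict (hom_vertex u) {u, v}" | "\<psi> = restrict (hom_vertex v) {v, u}"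
      | "\<psi> = restrict hom_empty {u, v}"
      | "\<psi> \<noteq> restrict (hom_vertex u) {u, v}" "\<psi> \<noteq> restrict (hom_vertex v) {u, v}"
        "\<psi> \<noteq> restrict hom_empty {u, v}"
      by (metis insert_commute)
    then show "N m e \<psi> = N m' e \<psi>"
    proof cases
      case 1
      then show ?thesis using NV[OF m E(1)] NV[OF m' E(1)] W uv by simp
    next
      case 2
      have "e = {v, u}" using uv by auto
      then show ?thesis using 2 NV[OF m E(2)] NV[OF m' E(2)] W by simp
    next
      case 3
      then show ?thesis using NO[OF m E(1)] NO[OF m' E(1)] W eq uv by simp
    next
      case 4
      then show ?thesis using N0[OF m E(1)] N0[OF m' E(1)] uv by simp
    qed
  qed
qed

text \<open>Every vertex is a successor, so the covering numbers can be written as linear balance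
  equations in the multiplicities. All later fibre arguments use this form.\<close>

lemma same_image_cyc_iff:
  assumes "Poly_Mapping.keys m \<subseteq> cocycle_homs" "Poly_Mapping.keys m' \<subseteq> cocycle_homs"
  shows "cocycle_image m = cocycle_image m' \<longleftrightarrow>
    monom_degree m = monom_degree m' \<and>
    (\<forall>i<2 * k. n_vertex m (cyc_succ i) + n_edge m (cyc_succ i) + n_edge m i =
      n_vertex m' (cyc_succ i) + n_edge m' (cyc_succ i) + n_edge m' i)"
  using weight_vertex[OF assms(1)] weight_vertex[OF assms(2)] cyc_succ_less cyc_succ_pred cyc_pred_less
  unfolding same_image_iff[OF assms] by metis

section \<open>Connecting a fibre by low-degree moves\<close>

text \<open>Congruence of monomials modulo the ideal generated in degree at most \<open>k\<close>.
  The \<open>itself\<close> argument carries the coefficient field, which the types of the monomials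
  do not mention.\<close>

definition move_equiv :: "'k::field itself \<Rightarrow> ((nat \<Rightarrow> nat) \<Rightarrow>\<^sub>0 nat) \<Rightarrow> ((nat \<Rightarrow> nat) \<Rightarrow>\<^sub>0 nat) \<Rightarrow> bool" where
  "move_equiv _ m m' \<longleftrightarrow>
     (mpoly_monom m - mpoly_monom m' :: (nat \<Rightarrow> nat, 'k) mpoly) \<in>
       Idl\<^bsub>mpoly_ring cocycle_homs\<^esub> (binomials_upto (toric_ideal cocycle Lambda_graph) k)"

lemma move_equiv_refl: "move_equiv TYPE('k::field) m m"
  using additive_subgroup.zero_closed[OF ideal.axioms(1)[OF ideal_low_binomials]]
  by (simp add: move_equiv_def)

lemma move_equiv_trans:
  "move_equiv TYPE('k::field) m m' \<Longrightarrow> move_equiv TYPE('k) m' m'' \<Longrightarrow> move_equiv TYPE('k) m m''"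
  using additive_subgroup.a_closed[OF ideal.axioms(1)[OF ideal_low_binomials],
    of "mpoly_monom m - mpoly_monom m' :: (nat \<Rightarrow> nat, 'k) mpoly"]
  unfolding move_equiv_def by fastforce

lemma move_equiv_sym:
  assumes "move_equiv TYPE('k::field) m m'"
  shows "move_equiv TYPE('k) m' m"
proof -
  have "- 1 \<in> carrier (mpoly_ring cocycle_homs :: (nat \<Rightarrow> nat, 'k) mpoly ring)"
    by simp
  from ideal.I_l_closed[OF ideal_low_binomials assms[unfolded move_equiv_def] this]
  show ?thesis by (simp add: move_equiv_def)
qed

lemma move_equiv_add:
  assumes "move_equiv TYPE('k::field) m m'" "Poly_Mapping.keys r \<subseteq> cocycle_homs"
  shows "move_equiv TYPE('k) (m + r) (m' + r)"
proof -
  have "mpoly_monom r \<in> carrier (mpoly_ring cocycle_homs :: (nat \<Rightarrow> nat, 'k) mpoly ring)"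
    using assms(2) by simp
  from ideal.I_r_closed[OF ideal_low_binomials assms(1)[unfolded move_equiv_def] this]
  show ?thesis by (simp add: move_equiv_def left_diff_distrib mpoly_monom_mult)
qed

text \<open>By \<open>le\<close> the monomial \<open>u\<close> divides \<open>m\<close>, so the
  subtraction \<open>m - u\<close> is exact, and multiplying the binomial of \<open>u\<close> and
  \<open>u'\<close> by this cofactor yields the congruence.\<close>

lemma apply_move:
  assumes u: "Poly_Mapping.keys u \<subseteq> cocycle_homs" "Poly_Mapping.keys u' \<subseteq> cocycle_homs"
    "cocycle_image u = cocycle_image u'"
      "monom_degree u \<le> k"
    and m: "Poly_Mapping.keys m \<subseteq> cocycle_homs"
      and le: "\<And>\<phi>. Poly_Mapping.lookup u \<phi> \<le> Poly_Mapping.lookup m \<phi>"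
  shows "move_equiv TYPE('k::field) m (m - u + u')" "cocycle_image (m - u + u') = cocycle_image m"
    "Poly_Mapping.keys (m - u + u') \<subseteq> cocycle_homs"
proof -
  have eq: "m = u + (m - u)"
    using le by (intro poly_mapping_eqI) (simp add: lookup_add lookup_minus)
  have r: "Poly_Mapping.keys (m - u) \<subseteq> cocycle_homs"
    using m by (auto simp: in_keys_iff lookup_minus subset_iff)
  have "monom_degree u' \<le> k"
    using same_image_cyc_iff[OF u(1,2)] u(3,4) by simp
  then have "move_equiv TYPE('k) u u'"
    unfolding move_equiv_def
    using u
    by (intro subsetD[OF ring.genideal_self[OF cring.axioms(1)[OF cring_mpoly_ring] binomials_upto_subset]]
        monom_diff_in_binomials_upto)
  from move_equiv_add[OF this r] show "move_equiv TYPE('k) m (m - u + u')"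
    using eq by (simp add: add.commute)
  show "cocycle_image (m - u + u') = cocycle_image m"
    using arg_cong[OF eq, of cocycle_image] u(3) by (simp add: monom_image_add add.commute)
  show "Poly_Mapping.keys (m - u + u') \<subseteq> cocycle_homs"
    by (rule keys_add_subset[OF r u(2)])
qed

lemma hom_mem: "hom_empty \<in> cocycle_homs" "i < 2 * k \<Longrightarrow> hom_vertex i \<in> cocycle_homs"
  "i < 2 * k \<Longrightarrow> hom_edge i \<in> cocycle_homs"
  by (auto simp: cocycle_homs_eq)

lemmas succ_simps = cyc_succ_less cyc_succ_neq cyc_succ_pred cyc_pred_less

text \<open>Both sides have degree 2 and cover \<open>i\<close> and its successor once.\<close>

lemma join_move:
  assumes "i < 2 * k"
  shows "cocycle_image (Poly_Mapping.single (hom_vertex i) 1 + Poly_Mapping.single (hom_vertex (cyc_succ i)) 1) =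
    cocycle_image (Poly_Mapping.single (hom_edge i) 1 + Poly_Mapping.single hom_empty 1)"
proof -
  note succ = succ_simps(1)[of i] succ_simps(1)[of "cyc_succ i"]
  show ?thesis
  proof (subst same_image_iff, goal_cases)
    case 3
    then show ?case
      using assms succ succ_simps by (auto simp: monom_degree_add monom_degree_single weight_add
          hom_empty_apply hom_vertex_apply hom_edge_apply)
  next
    case 1
    show ?case by (intro keys_two_singles hom_mem assms succ)
  next
    case 2
    show ?case by (intro keys_two_singles hom_mem assms succ)
  qed
qed

text \<open>The two ways to split a path of three consecutive vertices into an edge and a
  vertex.\<close>

lemma slide_move:
  assumes "i < 2 * k"
  shows "cocycle_image (Poly_Mapping.single (hom_vertex i) 1 + Poly_Mapping.single (hom_edge (cyc_succ i)) 1) =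
    cocycle_image (Poly_Mapping.single (hom_edge i) 1 + Poly_Mapping.single (hom_vertex (cyc_succ (cyc_succ i))) 1)"
proof -
  note succ = succ_simps(1)[of i] succ_simps(1)[of "cyc_succ i"]
  show ?thesis
  proof (subst same_image_iff, goal_cases)
    case 3
    then show ?case
      using assms succ succ_simps by (auto simp: monom_degree_add monom_degree_single weight_add
          hom_empty_apply hom_vertex_apply hom_edge_apply)
  next
    case 1
    show ?case by (intro keys_two_singles hom_mem assms succ)
  next
    case 2
    show ?case by (intro keys_two_singles hom_mem assms succ)
  qed
qed

text \<open>The l1 distance of the edge multiplicities; differences are taken in \<open>int\<close>
  to avoid truncation. Within a fibre it vanishes only for equal monomials.\<close>

definition edge_dist :: "((nat \<Rightarrow> nat) \<Rightarrow>\<^sub>0 nat) \<Rightarrow> ((nat \<Rightarrow> nat) \<Rightarrow>\<^sub>0 nat) \<Rightarrow> nat" where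
  "edge_dist m m' = (\<Sum>i<2 * k. nat \<bar>int (n_edge m i) - int (n_edge m' i)\<bar>)"

lemma edge_dist_less:
  assumes "\<And>i. i < 2 * k \<Longrightarrow> \<bar>int (n_edge m1 i) - int (n_edge m' i)\<bar>
    \<le> \<bar>int (n_edge m i) - int (n_edge m' i)\<bar>"
    and "j < 2 * k" "\<bar>int (n_edge m1 j) - int (n_edge m' j)\<bar> < \<bar>int (n_edge m j) - int (n_edge m' j)\<bar>"
  shows "edge_dist m1 m' < edge_dist m m'"
  unfolding edge_dist_def
proof (rule sum_strict_mono_ex1)
  show "\<exists>i\<in>{..<2 * k}. nat \<bar>int (n_edge m1 i) - int (n_edge m' i)\<bar> < nat \<bar>int (n_edge m i) - int (n_edge m' i)\<bar>"
    using assms(2,3) by (intro bexI[of _ j]) auto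
qed (use assms(1) in \<open>auto intro!: nat_mono\<close>)

lemma edge_dist_commute: "edge_dist m m' = edge_dist m' m"
  unfolding edge_dist_def by (intro sum.cong refl) (metis abs_minus_commute)

lemmas lookup_simps = lookup_add lookup_minus lookup_single when_def

lemma improving_move:
  assumes m: "Poly_Mapping.keys m \<subseteq> cocycle_homs" and m': "Poly_Mapping.keys m' \<subseteq> cocycle_homs"
    and im: "cocycle_image m = cocycle_image m'"
    and i: "i < 2 * k" "n_edge m i < n_edge m' i"
      and free: "n_vertex m i > 0 \<or> n_vertex m (cyc_succ i) > 0"
  obtains m1 where "move_equiv TYPE('k::field) m m1" "cocycle_image m1 = cocycle_image m"
    "Poly_Mapping.keys m1 \<subseteq> cocycle_homs"
    "edge_dist m1 m' < edge_dist m m'"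
proof -
  let ?s = "cyc_succ i" and ?p = "cyc_pred i"
  have s: "?s < 2 * k" "?s \<noteq> i" "cyc_succ ?s < 2 * k"
    using i succ_simps by auto
  have p: "?p < 2 * k" "cyc_succ ?p = i" "?p \<noteq> i"
    using i succ_simps by metis+
  have bal: "n_vertex m (cyc_succ j) + n_edge m (cyc_succ j) + n_edge m j
    = n_vertex m' (cyc_succ j) + n_edge m' (cyc_succ j) + n_edge m' j"
    if "j < 2 * k" for j
    using same_image_cyc_iff[OF m m'] im that by simp
  have deg: "monom_degree (Poly_Mapping.single x 1 + Poly_Mapping.single y 1) \<le> k"
    for x y :: "nat \<Rightarrow> nat"
    using k2 by (simp add: monom_degree_add monom_degree_single)
  \<comment> \<open>Edge \<open>i\<close> is too rare in \<open>m\<close>. Balance at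
    \<open>?s\<close> therefore forces a singleton there or a surplus of edge \<open>?s\<close>, and
    balance at \<open>i\<close> forces a singleton there or a surplus of edge \<open>?p\<close>.
    Together with \<open>free\<close> one of three moves is available.\<close>
  have "n_vertex m i > 0 \<and> n_vertex m ?s > 0 \<or> n_vertex m i > 0 \<and> n_edge m ?s > n_edge m' ?s
    \<or> n_vertex m ?s > 0 \<and> n_edge m ?p > n_edge m' ?p"
    using free bal[OF i(1)] bal[OF p(1), unfolded p(2)] i(2) by linarith
  then consider "n_vertex m i > 0" "n_vertex m ?s > 0" | "n_vertex m i > 0" "n_edge m ?s > n_edge m' ?s"
    | "n_vertex m ?s > 0" "n_edge m ?p > n_edge m' ?p"
    by metis
  then show ?thesis
  proof cases
    case 1
    let ?u = "Poly_Mapping.single (hom_vertex i) 1 + Poly_Mapping.single (hom_vertex ?s) 1"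
    let ?u' = "Poly_Mapping.single (hom_edge i) 1 + Poly_Mapping.single hom_empty 1"
    have "Poly_Mapping.lookup ?u \<phi> \<le> Poly_Mapping.lookup m \<phi>" for \<phi>
      using 1 i s by (auto simp: lookup_simps hom_distinct)
    note mv = apply_move[OF _ _ join_move[OF i(1)] deg m this]
    have edges: "n_edge (m - ?u + ?u') j = n_edge m j + of_bool (j = i)" if "j < 2 * k" for j
      using that i s by (auto simp: lookup_simps hom_distinct)
    have "edge_dist (m - ?u + ?u') m' < edge_dist m m'"
      by (rule edge_dist_less[of _ _ _ i]) (use i edges in auto)
    then show ?thesis
      using i s by (intro that[OF mv] keys_two_singles hom_mem) auto
  next
    case 2
    let ?u = "Poly_Mapping.single (hom_vertex i) 1 + Poly_Mapping.single (hom_edge ?s) 1"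
    let ?u' = "Poly_Mapping.single (hom_edge i) 1 + Poly_Mapping.single (hom_vertex (cyc_succ ?s)) 1"
    have "Poly_Mapping.lookup ?u \<phi> \<le> Poly_Mapping.lookup m \<phi>" for \<phi>
      using 2 i s by (auto simp: lookup_simps hom_distinct)
    note mv = apply_move[OF _ _ slide_move[OF i(1)] deg m this]
    have edges: "n_edge (m - ?u + ?u') j = n_edge m j - of_bool (j = ?s) + of_bool (j = i)"
      if "j < 2 * k" for j
      using that i s by (auto simp: lookup_simps hom_distinct)
    \<comment> \<open>Edge \<open>i\<close> gains where \<open>m\<close> has a deficit and edge
      \<open>?s\<close> loses where \<open>m\<close> has a surplus, so no term of the distance
      grows.\<close>
    have "edge_dist (m - ?u + ?u') m' < edge_dist m m'"
      by (rule edge_dist_less[of _ _ _ i]) (use i s 2 edges in auto)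
    then show ?thesis
      using i s by (intro that[OF mv] keys_two_singles hom_mem) auto
  next
    case 3
    let ?u = "Poly_Mapping.single (hom_edge ?p) 1 + Poly_Mapping.single (hom_vertex ?s) 1"
    let ?u' = "Poly_Mapping.single (hom_vertex ?p) 1 + Poly_Mapping.single (hom_edge i) 1"
    \<comment> \<open>The slide starting at \<open>?p\<close>, to be applied from right to left: its
      middle vertex is \<open>i\<close> and its last vertex is \<open>?s\<close>.\<close>
    have im: "cocycle_image ?u = cocycle_image ?u'"
      using slide_move[OF p(1)] unfolding p(2) by simp
    have "Poly_Mapping.lookup ?u \<phi> \<le> Poly_Mapping.lookup m \<phi>" for \<phi>
      using 3 i s p by (auto simp: lookup_simps hom_distinct)
    note mv = apply_move[OF _ _ im deg m this]
    have edges: "n_edge (m - ?u + ?u') j = n_edge m j - of_bool (j = ?p) + of_bool (j = i)"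
      if "j < 2 * k" for j
      using that i s p by (auto simp: lookup_simps hom_distinct)
    have "edge_dist (m - ?u + ?u') m' < edge_dist m m'"
      by (rule edge_dist_less[of _ _ _ i]) (use i p 3 edges in auto)
    then show ?thesis
      using i s p by (intro that[OF mv] keys_two_singles hom_mem) auto
  qed
qed

section \<open>The two perfect matchings and their fibre\<close>

definition matching :: "nat \<Rightarrow> ((nat \<Rightarrow> nat) \<Rightarrow>\<^sub>0 nat)" where
  "matching p = (\<Sum>i | i < 2 * k \<and> i mod 2 = p. Poly_Mapping.single (hom_edge i) 1)"

lemma lookup_matching:
  "n_empty (matching p) = 0"
  "j < 2 * k \<Longrightarrow> n_vertex (matching p) j = 0"
  "j < 2 * k \<Longrightarrow> n_edge (matching p) j = of_bool (j mod 2 = p)"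
proof -
  show "n_empty (matching p) = 0"
    unfolding matching_def lookup_sum by (rule sum.neutral) (auto simp: lookup_simps hom_distinct)
  assume j: "j < 2 * k"
  show "n_vertex (matching p) j = 0"
    unfolding matching_def lookup_sum
    by (rule sum.neutral) (use j in \<open>auto simp: lookup_simps hom_distinct\<close>)
  have "n_edge (matching p) j = (\<Sum>i | i < 2 * k \<and> i mod 2 = p. if i = j then 1 else 0)"
    unfolding matching_def lookup_sum
    by (rule sum.cong) (use j in \<open>auto simp: lookup_simps hom_distinct\<close>)
  then show "n_edge (matching p) j = of_bool (j mod 2 = p)"
    using j by simp
qed

lemma keys_matching: "Poly_Mapping.keys (matching p) \<subseteq> cocycle_homs"
proof -
  have "Poly_Mapping.lookup (matching p) \<phi> = 0" if "\<phi> \<notin> cocycle_homs" for \<phi>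
    unfolding matching_def lookup_sum
    by (rule sum.neutral) (use that hom_mem in \<open>auto simp: lookup_simps\<close>)
  then show ?thesis by (auto simp: in_keys_iff)
qed

text \<open>The length of the cycle is even, so the step from the last vertex back to 0 changes the
  parity as well.\<close>

lemma succ_parity: "i < 2 * k \<Longrightarrow> cyc_succ i mod 2 = 1 - i mod 2"
  by (simp add: mod_mod_cancel) presburger

lemma degree_matching:
  assumes "p < 2"
  shows "monom_degree (matching p) = k"
proof -
  have "(\<Sum>i<2 * l. of_bool (i mod 2 = p)) = l" for l :: nat
    using assms by (induction l) (auto simp: less_2_cases_iff)
  then show ?thesis
    by (simp add: degree_cocycle[OF keys_matching] lookup_matching)
qed

text \<open>A perfect matching covers every vertex exactly once. The right-hand side is free of
  \<open>p\<close>, which puts both matchings into one fibre.\<close>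

lemma same_image_matching_iff:
  assumes "p < 2" "Poly_Mapping.keys m \<subseteq> cocycle_homs"
  shows "cocycle_image m = cocycle_image (matching p) \<longleftrightarrow>
    monom_degree m = k \<and> (\<forall>i<2 * k. n_vertex m (cyc_succ i) + n_edge m (cyc_succ i) + n_edge m i = 1)"
proof -
  have "n_vertex (matching p) (cyc_succ i) + n_edge (matching p) (cyc_succ i) + n_edge (matching p) i
    = 1" if "i < 2 * k" for i
  proof -
    have "i mod 2 < 2" by simp
    then show ?thesis
      using that succ_parity[OF that] succ_simps(1)[of i] assms(1) lookup_matching
      by (auto simp: less_2_cases_iff simp del: succ_simps)
  qed
  then show ?thesis
    by (simp add: same_image_cyc_iff[OF assms(2) keys_matching] degree_matching[OF assms(1)])
qed

lemma image_matching_eq: "p < 2 \<Longrightarrow> q < 2 \<Longrightarrow> cocycle_image (matching p) = cocycle_image (matching q)"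
  using same_image_matching_iff[OF _ keys_matching, of q p] same_image_matching_iff[OF _ keys_matching, of p p]
  by simp

text \<open>Let O, V, E be the numbers of empty sets, singletons and edges. Counting covered
  vertices gives V + 2E = 2k, and the degree gives O + V + E = k, so O = V = 0. The multiplicities
  of neighbouring edges then add up to 1, and the edges alternate.\<close>

lemma matching_fibre:
  assumes p: "p < 2" and m: "Poly_Mapping.keys m \<subseteq> cocycle_homs"
    and im: "cocycle_image m = cocycle_image (matching p)"
  shows "m = matching 0 \<or> m = matching 1"
proof -
  have deg: "monom_degree m = k"
    and bal: "\<And>i. i < 2 * k \<Longrightarrow> n_vertex m (cyc_succ i) + n_edge m (cyc_succ i) + n_edge m i = 1"
    using same_image_matching_iff[OF p m] im by auto
  have bij: "bij_betw (\<lambda>i. cyc_succ i) {..<2 * k} {..<2 * k}"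
    by (rule bij_betwI[where g = cyc_pred]) (use succ_simps cyc_pred_succ in auto)
  have "(\<Sum>i<2 * k. n_vertex m (cyc_succ i) + n_edge m (cyc_succ i) + n_edge m i) = (\<Sum>i<2 * k. 1)"
    by (rule sum.cong) (use bal in auto)
  then have "(\<Sum>i<2 * k. n_vertex m i) + (\<Sum>i<2 * k. n_edge m i) + (\<Sum>i<2 * k. n_edge m i) = 2 * k"
    using sum.reindex_bij_betw[OF bij, of "n_vertex m"] sum.reindex_bij_betw[OF bij, of "n_edge m"]
    by (simp add: sum.distrib)
  then have O0: "n_empty m = 0" and "(\<Sum>i<2 * k. n_vertex m i) = 0"
    using deg unfolding degree_cocycle[OF m] by linarith+
  then have b0: "n_vertex m i = 0" if "i < 2 * k" for i
    using that by simp
  have step: "n_edge m (Suc i) = 1 - n_edge m i" "n_edge m i \<le> 1" if "Suc i < 2 * k" for i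
    using bal[of i] b0[of "Suc i"] that by auto
  have alt: "n_edge m i = (if even i then n_edge m 0 else 1 - n_edge m 0)" if "i < 2 * k" for i
    using that
  proof (induction i)
    case (Suc i)
    then show ?case using step[of i] step[of 0] k2 by (auto split: if_splits)
  qed simp
  have c0: "n_edge m 0 = 0 \<or> n_edge m 0 = 1"
    using step(2)[of 0] k2 by linarith
  \<comment> \<open>Edge 0 belongs to the matching of parity 0, so its multiplicity decides which
    matching \<open>m\<close> is.\<close>
  define q where "q = 1 - n_edge m 0"
  have cm: "n_edge m i = of_bool (i mod 2 = q)" if "i < 2 * k" for i
  proof (cases "even i")
    case True
    then have "i mod 2 = 0" by presburger
    then show ?thesis using alt[OF that] True c0 by (elim disjE) (simp_all add: q_def)
  next
    case False
    then have "i mod 2 = 1" by presburger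
    then show ?thesis using alt[OF that] False c0 by (elim disjE) (simp_all add: q_def)
  qed
  have "m = matching q"
    by (intro cocycle_monom_eqI[OF m keys_matching]) (simp_all add: lookup_matching O0 b0 cm)
  moreover have "q = 0 \<or> q = 1"
    using c0 q_def by linarith
  ultimately show ?thesis by blast
qed

text \<open>A label at one vertex propagates around the cycle to 0. From there the two labels
  alternate, so each parity class carries one of them; \<open>p\<close> is the class labelled
  \<open>down\<close>.\<close>

lemma alternating:
  fixes up down :: "nat \<Rightarrow> bool"
  assumes "\<And>i. i < 2 * k \<Longrightarrow> up i \<Longrightarrow> down (cyc_succ i)" "\<And>i. i < 2 * k \<Longrightarrow> down i \<Longrightarrow> up (cyc_succ i)"
    and "i < 2 * k" "up i \<or> down i"
  obtains p :: nat where "p < 2" "\<And>i. i < 2 * k \<Longrightarrow> i mod 2 = p \<Longrightarrow> down i"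
    "\<And>i. i < 2 * k \<Longrightarrow> i mod 2 = 1 - p \<Longrightarrow> up i"
proof -
  have reach: "up ((i + j) mod (2 * k)) \<or> down ((i + j) mod (2 * k))" for j
  proof (induction j)
    case 0
    then show ?case using assms(3,4) by simp
  next
    case (Suc j)
    have "(i + Suc j) mod (2 * k) = cyc_succ ((i + j) mod (2 * k))"
      by (simp add: mod_Suc_eq)
    then show ?case using Suc assms(1,2)[of "(i + j) mod (2 * k)"] k2 by auto
  qed
  \<comment> \<open>After \<open>2 * k - i\<close> steps from \<open>i\<close> the walk wraps around
    to 0.\<close>
  have "up 0 \<or> down 0"
    using reach[of "2 * k - i"] assms(3) by simp
  define p :: nat where "p = (if down 0 then 0 else 1)"
  have p: "p < 2" "p = 0 \<longrightarrow> down 0" "p = 1 \<longrightarrow> up 0"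
    using \<open>up 0 \<or> down 0\<close> by (auto simp: p_def)
  have all: "if i mod 2 = p then down i else up i" if "i < 2 * k" for i
    using that
  proof (induction i)
    case 0
    then show ?case using p by (auto simp: less_2_cases_iff)
  next
    case (Suc i)
    then show ?case
      using assms(1,2)[of i] p(1) by (auto simp: less_2_cases_iff mod_Suc split: if_splits)
  qed
  show ?thesis
    by (rule that[OF p(1)]) (use all p(1) in \<open>fastforce simp: less_2_cases_iff\<close>)+
qed

text \<open>Strong induction on the distance. A move may apply to either monomial, which is why both
  are generalised.\<close>

lemma fibre_connected:
  assumes "Poly_Mapping.keys m \<subseteq> cocycle_homs" "Poly_Mapping.keys m' \<subseteq> cocycle_homs"
    "cocycle_image m = cocycle_image m'"
  shows "move_equiv TYPE('k::field) m m'"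
  using assms
proof (induction "edge_dist m m'" arbitrary: m m' rule: less_induct)
  case less
  note m = less.prems(1) and m' = less.prems(2) and im = less.prems(3)
  have bal: "n_vertex m (cyc_succ j) + n_edge m (cyc_succ j) + n_edge m j
    = n_vertex m' (cyc_succ j) + n_edge m' (cyc_succ j) + n_edge m' j"
    if "j < 2 * k" for j
    using same_image_cyc_iff[OF m m'] im that by simp
  consider (left) i where "i < 2 * k" "n_edge m i < n_edge m' i"
    "n_vertex m i > 0 \<or> n_vertex m (cyc_succ i) > 0"
    | (right) i where "i < 2 * k" "n_edge m' i < n_edge m i"
      "n_vertex m' i > 0 \<or> n_vertex m' (cyc_succ i) > 0"
    | (equal) "\<And>i. i < 2 * k \<Longrightarrow> n_edge m i = n_edge m' i"
    | (cycle) i where "i < 2 * k" "n_edge m i \<noteq> n_edge m' i"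
      "\<And>j. j < 2 * k \<Longrightarrow> n_edge m j < n_edge m' j \<Longrightarrow> n_vertex m (cyc_succ j) = 0"
      "\<And>j. j < 2 * k \<Longrightarrow> n_edge m' j < n_edge m j \<Longrightarrow> n_vertex m' (cyc_succ j) = 0"
    by (metis gr0I)
  then show ?case
  proof cases
    case left
    obtain m1 where "move_equiv TYPE('k) m m1" "cocycle_image m1 = cocycle_image m"
      "Poly_Mapping.keys m1 \<subseteq> cocycle_homs"
      "edge_dist m1 m' < edge_dist m m'"
      using improving_move[OF m m' im left] by blast
    then show ?thesis
      using less.hyps[of m1 m'] m' im by (metis move_equiv_trans)
  next
    case right
    obtain m1 where "move_equiv TYPE('k) m' m1" "cocycle_image m1 = cocycle_image m'"
      "Poly_Mapping.keys m1 \<subseteq> cocycle_homs"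
      "edge_dist m1 m < edge_dist m' m"
      using improving_move[OF m' m im[symmetric] right] by blast
    then show ?thesis
      using less.hyps[of m m1] m im by (metis move_equiv_trans move_equiv_sym edge_dist_commute)
  next
    case equal
    have "n_vertex m i = n_vertex m' i" if "i < 2 * k" for i
      using bal[of "cyc_pred i"] equal[of "cyc_pred i"] equal[of i] that succ_simps by auto
    moreover have "n_empty m = n_empty m'"
      using same_image_cyc_iff[OF m m'] im equal calculation
      unfolding degree_cocycle[OF m] degree_cocycle[OF m'] by simp
    ultimately have "m = m'"
      using equal by (intro cocycle_monom_eqI[OF m m']) auto
    then show ?thesis by (simp add: move_equiv_refl)
  next
    case cycle
    obtain p where p: "p < 2" "\<And>i. i < 2 * k \<Longrightarrow> i mod 2 = p \<Longrightarrow> n_edge m' i < n_edge m i"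
      "\<And>i. i < 2 * k \<Longrightarrow> i mod 2 = 1 - p \<Longrightarrow> n_edge m i < n_edge m' i"
    proof (rule alternating[of "\<lambda>i. n_edge m i < n_edge m' i" "\<lambda>i. n_edge m' i < n_edge m i" i])
      \<comment> \<open>With no singleton of \<open>m\<close> at \<open>cyc_succ j\<close>, the
        balance there turns a deficit on edge \<open>j\<close> into a surplus on the next edge. The
        other direction exchanges \<open>m\<close> and \<open>m'\<close>.\<close>
      show "n_edge m' (cyc_succ j) < n_edge m (cyc_succ j)"
        if "j < 2 * k" "n_edge m j < n_edge m' j" for j
        using bal[OF that(1)] cycle(3)[OF that] that(2) by linarith
      show "n_edge m (cyc_succ j) < n_edge m' (cyc_succ j)"
        if "j < 2 * k" "n_edge m' j < n_edge m j" for j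
        using bal[OF that(1)] cycle(4)[OF that] that(2) by linarith
    qed (use cycle in auto)
    let ?m1 = "m - matching p + matching (1 - p)"
    have "cocycle_image (matching (1 - p)) = cocycle_image (matching p)"
      by (rule image_matching_eq) (use p(1) in simp_all)
    \<comment> \<open>The strict surplus on parity class \<open>p\<close> makes each of its edges
      occur in \<open>m\<close>, so the whole matching divides \<open>m\<close>.\<close>
    moreover have "Poly_Mapping.lookup (matching p) \<phi> \<le> Poly_Mapping.lookup m \<phi>" for \<phi>
    proof (cases "\<phi> \<in> cocycle_homs")
      case True
      then show ?thesis
        using p(2) by (fastforce simp: cocycle_homs_eq lookup_matching)
    next
      case False
      then show ?thesis using keys_matching[of p] by (metis in_keys_iff le0 subsetD)
    qed
    ultimately have mv: "move_equiv TYPE('k) m ?m1" "cocycle_image ?m1 = cocycle_image m"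
      "Poly_Mapping.keys ?m1 \<subseteq> cocycle_homs"
      using apply_move[OF keys_matching keys_matching _ _ m, of p "1 - p"] degree_matching[OF p(1)] by auto
    have edges: "n_edge ?m1 j = n_edge m j - of_bool (j mod 2 = p) + of_bool (j mod 2 = 1 - p)"
      if "j < 2 * k" for j
      using that by (simp add: lookup_add lookup_minus lookup_matching)
    have "edge_dist ?m1 m' < edge_dist m m'"
    \<comment> \<open>As \<open>p\<close> is 0 or 1, the index \<open>p\<close> itself has parity
      \<open>p\<close> and witnesses the strict decrease.\<close>
    proof (rule edge_dist_less[of _ _ _ p])
      show "p < 2 * k" using p(1) k2 by simp
      show "\<bar>int (n_edge ?m1 p) - int (n_edge m' p)\<bar> < \<bar>int (n_edge m p) - int (n_edge m' p)\<bar>"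
      proof -
        have "p < 2 * k" "p mod 2 = p" using p(1) k2 by auto
        moreover have "p \<noteq> 1 - p" by presburger
        ultimately show ?thesis using edges[of p] p(2)[of p] by simp
      qed
      show "\<bar>int (n_edge ?m1 j) - int (n_edge m' j)\<bar> \<le> \<bar>int (n_edge m j) - int (n_edge m' j)\<bar>"
        if "j < 2 * k" for j
      proof -
        have "j mod 2 = p \<and> j mod 2 \<noteq> 1 - p \<or> j mod 2 \<noteq> p \<and> j mod 2 = 1 - p"
          using p(1) by presburger
        then show ?thesis
          unfolding edges[OF that] using p(2,3)[OF that] by (elim disjE conjE) simp_all
      qed
    qed
    then show ?thesis
      using less.hyps[of ?m1 m'] mv m' im by (metis move_equiv_trans)
  qed
qed

text \<open>By \<open>monomial_map_kernel_subset\<close> it suffices to treat differences of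
  monomials in a common fibre, and \<open>fibre_connected\<close> places these in the generated
  ideal.\<close>

lemma toric_ideal_eq_genideal:
  "(toric_ideal cocycle Lambda_graph :: (nat \<Rightarrow> nat, 'k::field) mpoly set)
    = Idl\<^bsub>mpoly_ring cocycle_homs\<^esub>
        (binomials_upto (toric_ideal cocycle Lambda_graph) k)"
  (is "?I = ?J")
proof
  show "?J \<subseteq> ?I"
    by (rule ring.genideal_minimal[OF cring.axioms(1)[OF cring_mpoly_ring]
          ideal_toric_ideal[OF finite_graph_complement_cycle]])
      (auto simp: binomials_upto_def)
  show "?I \<subseteq> ?J"
  proof
    fix q :: "(nat \<Rightarrow> nat, 'k) mpoly" assume "q \<in> ?I"
    then have q: "q \<in> carrier (mpoly_ring cocycle_homs)"
      "mpoly_subst (\<lambda>\<phi>. mpoly_monom (edge_monom cocycle \<phi>)) q = 0"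
      unfolding toric_ideal_iff Phi_map_eq by blast+
    show "q \<in> ?J"
      by (rule monomial_map_kernel_subset[OF ideal_low_binomials _ q])
        (rule fibre_connected[unfolded move_equiv_def])
  qed
qed

section \<open>Necessity of degree k\<close>

lemma toric_ideal_neq_genideal:
  assumes "d < k"
  shows "(toric_ideal cocycle Lambda_graph :: (nat \<Rightarrow> nat, 'k::field) mpoly set)
    \<noteq> Idl\<^bsub>mpoly_ring cocycle_homs\<^esub>
        (binomials_upto (toric_ideal cocycle Lambda_graph) d)"
  (is "?I \<noteq> ?J")
proof
  assume eq: "?I = ?J"
  let ?K = "{q \<in> carrier (mpoly_ring cocycle_homs). \<forall>u v. u + v = matching 0 \<longrightarrow> Poly_Mapping.lookup q u
    = 0}
    :: (nat \<Rightarrow> nat, 'k) mpoly set"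
  \<comment> \<open>A proper divisor of \<open>matching 0\<close> is alone in its fibre: the
    cofactor \<open>v\<close> carries a second monomial of that fibre into the fibre of the
    matchings.\<close>
  have no_div: "m = m'"
    if m: "Poly_Mapping.keys m \<subseteq> cocycle_homs" "Poly_Mapping.keys m' \<subseteq> cocycle_homs"
      "cocycle_image m = cocycle_image m'"
      and deg: "monom_degree m < k" and v: "m + v = matching 0" for m m' v
  proof -
    have vX: "Poly_Mapping.keys v \<subseteq> cocycle_homs"
    proof -
      have "Poly_Mapping.lookup v \<phi> \<le> Poly_Mapping.lookup (matching 0) \<phi>" for \<phi>
        by (simp add: lookup_add flip: v)
      then show ?thesis
        using keys_matching[of 0] by (metis in_keys_iff le_zero_eq subset_iff)
    qed
    have "cocycle_image (m' + v) = cocycle_image (matching 0)"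
      using m(3) by (simp add: monom_image_add flip: v)
    then consider "m' + v = m + v" | "m' + v = matching 1"
      using matching_fibre[OF _ keys_add_subset[OF m(2) vX], of 0] v by auto
    then show ?thesis
    proof cases
      case 2
      \<comment> \<open>Here \<open>v\<close> divides both matchings, which share no variable since
        an edge index has only one parity. So \<open>v\<close> is trivial, against the degree bound
        on \<open>m\<close>.\<close>
      have "Poly_Mapping.lookup v \<phi> = 0" for \<phi>
      proof (cases "\<phi> \<in> cocycle_homs")
        case True
        have "Poly_Mapping.lookup v \<phi> \<le> Poly_Mapping.lookup (matching 0) \<phi>"
          by (simp add: lookup_add flip: v)
        moreover have "Poly_Mapping.lookup v \<phi> \<le> Poly_Mapping.lookup (matching 1) \<phi>"
          unfolding 2[symmetric] by (simp add: lookup_add)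
        ultimately have "Poly_Mapping.lookup v \<phi> = 0"
          if "Poly_Mapping.lookup (matching 0) \<phi> = 0 \<or> Poly_Mapping.lookup (matching 1) \<phi> = 0"
          using that by auto
        moreover have "x mod 2 = 1 \<or> x mod 2 = 0" for x :: nat
          by presburger
        ultimately show ?thesis
          using True by (auto simp: cocycle_homs_eq lookup_matching)
      next
        case False
        then show ?thesis using vX by (metis in_keys_iff subsetD)
      qed
      then have "v = 0" by (intro poly_mapping_eqI) simp
      then show ?thesis using v deg degree_matching[of 0] by simp
    qed simp
  qed
  have "binomials_upto ?I d \<subseteq> ?K"
  proof
    fix q :: "(nat \<Rightarrow> nat, 'k) mpoly" assume q: "q \<in> binomials_upto ?I d"
    then obtain m m' where qm: "q = mpoly_monom m - mpoly_monom m'" and qd: "total_degree q \<le> d"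
      and qI: "q \<in> ?I"
      unfolding binomials_upto_def by blast
    have qX: "q \<in> carrier (mpoly_ring cocycle_homs)" using qI unfolding toric_ideal_iff by blast
    show "q \<in> ?K"
    proof (cases "m = m'")
      case True
      then show ?thesis using qX by (simp add: qm)
    next
      case False
      have im: "cocycle_image m = cocycle_image m'"
        using qI unfolding toric_ideal_iff Phi_map_eq qm mpoly_subst_monom_diff by blast
      have mX: "Poly_Mapping.keys m \<subseteq> cocycle_homs" "Poly_Mapping.keys m' \<subseteq> cocycle_homs"
        using qX False by (simp_all add: qm keys_mpoly_monom_diff)
      have deg: "monom_degree m < k" "monom_degree m' < k"
        using qd assms False by (simp_all add: qm total_degree_monom_diff)
      have "u \<notin> Poly_Mapping.keys q" if "u + v = matching 0" for u v
        using that no_div[OF mX im deg(1)] no_div[OF mX(2,1) im[symmetric] deg(2)] False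
        by (auto simp: qm keys_mpoly_monom_diff)
      then show ?thesis using qX by (auto simp: in_keys_iff simp del: mpoly_ring_simps(1))
    qed
  qed
  then have "?I \<subseteq> ?K"
    unfolding eq[symmetric]
    by (subst eq) (rule ring.genideal_minimal[OF cring.axioms(1)[OF cring_mpoly_ring] ideal_nondivisors])
  moreover have "mpoly_monom (matching 0) - mpoly_monom (matching 1) \<in> ?I"
    using monom_diff_in_binomials_upto[OF keys_matching keys_matching image_matching_eq[of 0 1], of k, where 'k = 'k]
    unfolding binomials_upto_def by (simp add: degree_matching)
  moreover have "matching 0 \<noteq> matching 1"
    using lookup_matching(3)[of 0 0] lookup_matching(3)[of 0 1] k2 by auto
  then have "Poly_Mapping.lookup (mpoly_monom (matching 0) - mpoly_monom (matching 1) :: (nat \<Rightarrow> nat, 'k) mpoly)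
      (matching 0) = 1"
    by (simp add: mpoly_monom_def lookup_minus lookup_single when_def)
  \<comment> \<open>The monomial \<open>matching 0\<close> divides itself with cofactor 0, so its
    coefficient would have to vanish, yet it is 1.\<close>
  ultimately show False
    by (smt (verit) add.right_neutral mem_Collect_eq subsetD zero_neq_one)
qed

end

theorem theorem7p3:
  fixes k :: nat
  assumes "k \<ge> 2"
  shows "markov_width
           (graph_homs (complement_graph (cycle_graph (2 * k))) Lambda_graph)
           (toric_ideal (complement_graph (cycle_graph (2 * k))) Lambda_graph
              :: (nat \<Rightarrow> nat, 'k::field) mpoly set) = k"
  unfolding markov_width_def
  by (rule Least_equality)
    (use toric_ideal_eq_genideal[OF assms] toric_ideal_neq_genideal[OF assms] in \<open>auto simp: not_le[symmetric]\<close>)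

end
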